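(* Let $\mathfrak{n}=\mathfrak{n}_1\oplus\mathfrak{n}_2$ be a real vector space with $\dim\mathfrak{n}_1=2p$ and $\dim\mathfrak{n}_2=2q$, put $n=p+q$, and let $J:\mathfrak{n}\to\mathfrak{n}$ be a linear map with $J^2=-I$ and $J\mathfrak{n}_i=\mathfrak{n}_i$ for $i=1,2$. Let $\langle\cdot,\cdot\rangle$ be a fixed inner product on $\mathfrak{n}$ such that $\langle JX,JY\rangle=\langle X,Y\rangle$ for all $X,Y\in\mathfrak{n}$ and $\mathfrak{n}_1\perp\mathfrak{n}_2$. Let $\mu,\lambda\in\Lambda^2\mathfrak{n}_1^*\otimes\mathfrak{n}_2$ satisfy $\mu(\mathfrak{n}_1,\mathfrak{n}_1)=\lambda(\mathfrak{n}_1,\mathfrak{n}_1)=\mathfrak{n}_2$ (the linear span of the values is all of $\mathfrak{n}_2$). If $\lambda\in\mathrm{GL}_n(\mathbb{C})\cdot\mu$, then $$f(\lambda)\in\mathbb{R}_{>0}\,\mathrm{GL}_q(\mathbb{C})\cdot f(\mu),$$ where $f(\mu)$ and $f(\lambda)$ are the Pfaffian forms of the $2$-step nilpotent Lie algebras $(\mathfrak{n},\mu)$ and $(\mathfrak{n},\lambda)$, respectively.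
   Context: An element $\mu\in\Lambda^2\mathfrak{n}_1^*\otimes\mathfrak{n}_2$ is a skew-symmetric bilinear map $\mathfrak{n}_1\times\mathfrak{n}_1\to\mathfrak{n}_2$; it is extended by $\mu(\mathfrak{n},\mathfrak{n}_2)=0$ to a ($2$-step nilpotent) Lie bracket on $\mathfrak{n}$. $\mathrm{GL}_n(\mathbb{C}):=\{g\in\mathrm{GL}(\mathfrak{n}): gJ=Jg\}$ acts on skew-symmetric bilinear maps $\mathfrak{n}\times\mathfrak{n}\to\mathfrak{n}$ by $(g\cdot\mu)(X,Y)=g\,\mu(g^{-1}X,g^{-1}Y)$. Similarly $\mathrm{GL}_q(\mathbb{C}):=\{h\in\mathrm{GL}(\mathfrak{n}_2): hJ|_{\mathfrak{n}_2}=J|_{\mathfrak{n}_2}h\}$, which acts on real homogeneous polynomial functions $f$ on $\mathfrak{n}_2$ by $(h\cdot f)(Z)=f(h^{-1}Z)$; $\mathbb{R}_{>0}\,\mathrm{GL}_q(\mathbb{C})\cdot f$ denotes the set of all $r\,(h\cdot f)$ with $r>0$, $h\in\mathrm{GL}_q(\mathbb{C})$. Pfaffian form: for $Z\in\mathfrak{n}_2$ let $J_\mu(Z):\mathfrak{n}_1\to\mathfrak{n}_1$ be the skew-symmetric map defined by $\langle J_\mu(Z)X,Y\rangle=\langle\mu(X,Y),Z\rangle$ for all $X,Y\in\mathfrak{n}_1$. The Pfaffian form of $(\mathfrak{n},\mu)$ is the function $f(\mu):\mathfrak{n}_2\to\mathbb{R}$, $f(\mu)(Z)=\mathrm{Pf}(J_\mu(Z))$,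 which is a homogeneous polynomial of degree $p$ in $2q$ variables. Here $\mathrm{Pf}:\mathfrak{so}(\mathfrak{n}_1)\to\mathbb{R}$ is the unique polynomial function such that $\mathrm{Pf}(B)^2=\det B$ for all $B\in\mathfrak{so}(\mathfrak{n}_1)$ and $\mathrm{Pf}(J|_{\mathfrak{n}_1})=1$. *)

theory Defs
  imports "HOL-Analysis.Analysis"
begin

text \<open>
  The ambient Euclidean space plays the role of the real vector space together with its fixed
  inner product; the summands of a decomposition are subspaces of it.
\<close>

definition direct_sum_decomp :: "'a::euclidean_space set \<Rightarrow> 'a set \<Rightarrow> bool" where
  "direct_sum_decomp V W \<longleftrightarrow>
     subspace V \<and> subspace W \<and> V \<inter> W = {0} \<and> {x + y |x y. x \<in> V \<and> y \<in> W} = UNIV"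

text \<open>
  \<open>\<Lambda>\<^sup>2 V\<^sup>* \<otimes> W\<close>, each element being identified with its extension by zero to the direct sum
  of \<open>V\<close> and \<open>W\<close>.
\<close>

definition skew_bilinear_maps ::
  "'a::euclidean_space set \<Rightarrow> 'a set \<Rightarrow> ('a \<Rightarrow> 'a \<Rightarrow> 'a) set" where
  "skew_bilinear_maps V W = {\<mu>. bilinear \<mu> \<and> (\<forall>X Y. \<mu> X Y = - \<mu> Y X) \<and>
     (\<forall>X\<in>V. \<forall>Y\<in>V. \<mu> X Y \<in> W) \<and> (\<forall>X. \<forall>Y\<in>W. \<mu> X Y = 0)}"

text \<open>
  The \<open>J\<close>-linear automorphisms of a \<open>J\<close>-invariant subspace \<open>V\<close>.  An automorphism of \<open>V\<close> is
  represented by any linear extension to the ambient space; only its values on \<open>V\<close> are used below.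
\<close>

definition GL_complex :: "'a::euclidean_space set \<Rightarrow> ('a \<Rightarrow> 'a) \<Rightarrow> ('a \<Rightarrow> 'a) set" where
  "GL_complex V J = {g. linear g \<and> bij_betw g V V \<and> (\<forall>x\<in>V. g (J x) = J (g x))}"

definition bracket_act :: "('a \<Rightarrow> 'a) \<Rightarrow> ('a \<Rightarrow> 'a \<Rightarrow> 'a) \<Rightarrow> 'a \<Rightarrow> 'a \<Rightarrow> 'a" where
  "bracket_act g \<mu> = (\<lambda>X Y. g (\<mu> (inv g X) (inv g Y)))"

definition bracket_orbit ::
  "('a::euclidean_space \<Rightarrow> 'a) \<Rightarrow> ('a \<Rightarrow> 'a \<Rightarrow> 'a) \<Rightarrow> ('a \<Rightarrow> 'a \<Rightarrow> 'a) set" where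
  "bracket_orbit J \<mu> = {bracket_act g \<mu> |g. g \<in> GL_complex UNIV J}"

text \<open>Functions on a subspace are functions on the ambient space that are extensional on it.\<close>

definition form_act :: "'a set \<Rightarrow> ('a \<Rightarrow> 'a) \<Rightarrow> ('a \<Rightarrow> real) \<Rightarrow> 'a \<Rightarrow> real" where
  "form_act W h f = (\<lambda>Z\<in>W. f (inv_into W h Z))"

definition pos_form_orbit ::
  "'a::euclidean_space set \<Rightarrow> ('a \<Rightarrow> 'a) \<Rightarrow> ('a \<Rightarrow> real) \<Rightarrow> ('a \<Rightarrow> real) set" where
  "pos_form_orbit W J f =
     {(\<lambda>Z\<in>W. r * form_act W h f Z) |r h. r > 0 \<and> h \<in> GL_complex W J}"

text \<open>
  Leibniz formula for the determinant of an endomorphism of the subspace \<open>V\<close>, with matrix entries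
  taken in an orthonormal basis of \<open>V\<close>; the value does not depend on the basis.
\<close>

definition det_on :: "'a::euclidean_space set \<Rightarrow> ('a \<Rightarrow> 'a) \<Rightarrow> real" where
  "det_on V L =
     (let b = (SOME b. pairwise orthogonal b \<and> (\<forall>x\<in>b. norm x = 1) \<and> span b = V)
      in \<Sum>\<pi> | \<pi> permutes b. of_int (sign \<pi>) * (\<Prod>x\<in>b. L x \<bullet> \<pi> x))"

text \<open>
  \<open>\<ss>\<oo>(V)\<close>, an endomorphism of \<open>V\<close> being extended by zero to the orthogonal complement of \<open>V\<close>.
  In this way it is a linear subspace of the normed space of operators on the ambient space, and
  its polynomial functions are the restrictions of those of that normed space.
\<close>

definition so_on :: "'a::euclidean_space set \<Rightarrow> ('a \<Rightarrow>\<^sub>L 'a) set" where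
  "so_on V = {B. (\<forall>x\<in>V. blinfun_apply B x \<in> V) \<and>
     (\<forall>x\<in>V. \<forall>y\<in>V. blinfun_apply B x \<bullet> y = - (x \<bullet> blinfun_apply B y)) \<and>
     (\<forall>x\<in>orthogonal_comp V. blinfun_apply B x = 0)}"

text \<open>
  The Pfaffian on \<open>\<ss>\<oo>(V)\<close>, normalised to be \<open>1\<close> at the restriction of \<open>J\<close> to \<open>V\<close>.
\<close>

definition pfaffian ::
  "'a::euclidean_space set \<Rightarrow> ('a \<Rightarrow> 'a) \<Rightarrow> ('a \<Rightarrow>\<^sub>L 'a) \<Rightarrow> real" where
  "pfaffian V J = (THE P. P \<in> extensional (so_on V) \<and>
     (\<exists>Q. real_polynomial_function Q \<and> (\<forall>B\<in>so_on V. P B = Q B)) \<and>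
     (\<forall>B\<in>so_on V. (P B)\<^sup>2 = det_on V (blinfun_apply B)) \<and>
     (\<exists>B\<in>so_on V. (\<forall>x\<in>V. blinfun_apply B x = J x) \<and> P B = 1))"

definition J_map ::
  "'a::euclidean_space set \<Rightarrow> ('a \<Rightarrow> 'a \<Rightarrow> 'a) \<Rightarrow> 'a \<Rightarrow> ('a \<Rightarrow>\<^sub>L 'a)" where
  "J_map V \<mu> Z = (THE B. B \<in> so_on V \<and>
     (\<forall>X\<in>V. \<forall>Y\<in>V. blinfun_apply B X \<bullet> Y = \<mu> X Y \<bullet> Z))"

definition pfaffian_form ::
  "'a::euclidean_space set \<Rightarrow> 'a set \<Rightarrow> ('a \<Rightarrow> 'a) \<Rightarrow> ('a \<Rightarrow> 'a \<Rightarrow> 'a) \<Rightarrow> 'a \<Rightarrow> real" where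
  "pfaffian_form V W J \<mu> = (\<lambda>Z\<in>W. pfaffian V J (J_map V \<mu> Z))"

end

theory Submission
  imports Defs
begin

text \<open>
  If \<open>\<lambda> = g \<cdot> \<mu>\<close>, then \<open>g\<close> preserves \<open>n2\<close>, the span of the values of \<open>\<lambda>\<close>; let \<open>k\<close> be the
  transpose of \<open>g\<close> restricted to \<open>n2\<close> and \<open>a\<close> the compression of \<open>g\<^sup>-\<^sup>1\<close> to \<open>n1\<close>.  Both commute with
  \<open>J\<close>, and \<open>\<langle>\<lambda>(X, Y), Z\<rangle> = \<langle>\<mu>(a X, a Y), k Z\<rangle>\<close>, so the skew map of \<open>\<lambda>\<close> at \<open>Z\<close> is \<open>a\<^sup>T B a\<close> with \<open>B\<close>
  that of \<open>\<mu>\<close> at \<open>k Z\<close>.  Hence \<open>f(\<lambda>)(Z) = det a \<cdot> f(\<mu>)(k Z)\<close>, where \<open>det a > 0\<close> because \<open>a\<close> is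
  \<open>J\<close>-linear.

  That the polynomial square root of the determinant exists is seen on the signed sum over all
  permutations, which changes under congruence by the determinant of the base change: as all
  nondegenerate skew forms are congruent, its square is a constant multiple of the determinant.
\<close>

section \<open>Determinants and Pfaffians as signed sums over permutations\<close>

text \<open>The determinant of a matrix indexed by the set \<open>I\<close> itself, so that an
  orthonormal basis can index its own matrices without being enumerated.\<close>

definition leibniz_sum :: "'i set \<Rightarrow> ('i \<Rightarrow> 'i \<Rightarrow> real) \<Rightarrow> real" where
  "leibniz_sum I A = (\<Sum>\<pi> | \<pi> permutes I. of_int (sign \<pi>) * (\<Prod>i\<in>I. A i (\<pi> i)))"

text \<open>If \<open>T\<close> pairs \<open>S\<close> with its complement and \<open>A\<close> is
  skew, this is the Pfaffian times \<open>2^p * p!\<close> for \<open>p = card S\<close>: each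
  perfect matching is counted once for every ordering and orientation of its edges. A later
  normalisation divides the factor out.\<close>

definition pf_sum :: "'i set \<Rightarrow> 'i set \<Rightarrow> ('i \<Rightarrow> 'i) \<Rightarrow> ('i \<Rightarrow> 'i \<Rightarrow> real) \<Rightarrow> real" where
  "pf_sum I S T A =
     (\<Sum>\<pi> | \<pi> permutes I. of_int (sign \<pi>) * (\<Prod>s\<in>S. A (\<pi> s) (\<pi> (T s))))"

section \<open>Determinants: transposition, products and vanishing\<close>

lemma leibniz_sum_cong:
  assumes "\<And>i j. i \<in> I \<Longrightarrow> j \<in> I \<Longrightarrow> A i j = B i j"
  shows "leibniz_sum I A = leibniz_sum I B"
  unfolding leibniz_sum_def
  by (intro sum.cong arg_cong2[where f = "(*)"] prod.cong refl)
     (auto simp: assms permutes_in_image)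

lemma sign_permutes_compose:
  assumes "finite I" "p permutes I" "q permutes I"
  shows "sign (p \<circ> q) = sign p * sign q"
  using assms by (intro sign_compose) (auto simp: permutation_permutes)

lemma leibniz_sum_transpose:
  assumes "finite I"
  shows "leibniz_sum I (\<lambda>i j. A j i) = leibniz_sum I A"
proof -
  have "leibniz_sum I (\<lambda>i j. A j i) =
      (\<Sum>\<pi> | \<pi> permutes I. of_int (sign (inv \<pi>)) * (\<Prod>i\<in>I. A (inv \<pi> i) i))"
    unfolding leibniz_sum_def by (subst sum_permutations_inverse) simp
  also have "\<dots> = leibniz_sum I A"
    unfolding leibniz_sum_def
  proof (rule sum.cong[OF refl])
    fix p assume "p \<in> {p. p permutes I}"
    then have p: "p permutes I" by simp
    have "(\<Prod>i\<in>I. A (inv p i) i) = (\<Prod>i\<in>I. A (inv p (p i)) (p i))"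
      by (rule prod.reindex_bij_betw[OF permutes_imp_bij[OF p], symmetric])
    then have "(\<Prod>i\<in>I. A (inv p i) i) = (\<Prod>i\<in>I. A i (p i))"
      by (simp add: permutes_inverses[OF p])
    moreover have "sign (inv p) = sign p"
      using p assms by (intro sign_inverse) (auto simp: permutation_permutes)
    ultimately show "of_int (sign (inv p)) * (\<Prod>i\<in>I. A (inv p i) i) =
        of_int (sign p) * (\<Prod>i\<in>I. A i (p i))"
      by simp
  qed
  finally show ?thesis .
qed

lemma leibniz_sum_selected_columns_permutes:
  assumes "finite I" and f: "f permutes I"
  shows "(\<Sum>\<pi> | \<pi> permutes I. of_int (sign \<pi>) * (\<Prod>i\<in>I. m (\<pi> i) (f i))) =
    of_int (sign f) * leibniz_sum I m"
proof -
  have "(\<Sum>\<pi> | \<pi> permutes I. of_int (sign \<pi>) * (\<Prod>i\<in>I. m (\<pi> i) (f i))) =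
      (\<Sum>\<pi> | \<pi> permutes I. of_int (sign (\<pi> \<circ> f)) * (\<Prod>i\<in>I. m ((\<pi> \<circ> f) i) (f i)))"
    by (rule sum_permutations_compose_right[OF f])
  also have "\<dots> = (\<Sum>\<pi> | \<pi> permutes I. of_int (sign f) * (of_int (sign \<pi>) * (\<Prod>i\<in>I. m (\<pi> i) i)))"
  proof (rule sum.cong[OF refl])
    fix p assume "p \<in> {p. p permutes I}"
    then have p: "p permutes I" by simp
    have "(\<Prod>i\<in>I. m ((p \<circ> f) i) (f i)) = (\<Prod>i\<in>I. m (p i) i)"
      using prod.reindex_bij_betw[OF permutes_imp_bij[OF f], of "\<lambda>i. m (p i) i"] by simp
    then show "of_int (sign (p \<circ> f)) * (\<Prod>i\<in>I. m ((p \<circ> f) i) (f i)) =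
        of_int (sign f) * (of_int (sign p) * (\<Prod>i\<in>I. m (p i) i))"
      by (simp add: sign_permutes_compose[OF assms(1) p f])
  qed
  also have "\<dots> = of_int (sign f) * leibniz_sum I (\<lambda>i j. m j i)"
    by (simp add: leibniz_sum_def sum_distrib_left)
  finally show ?thesis using leibniz_sum_transpose[OF assms(1), of m] by simp
qed

text \<open>Precomposing with the swap of \<open>i\<close> and \<open>j\<close> keeps every product
  and reverses every sign, so the sum equals its own negative.\<close>

lemma leibniz_sum_selected_columns_not_inj:
  assumes "finite I" and "i \<in> I" "j \<in> I" "i \<noteq> j" "f i = f j"
  shows "(\<Sum>\<pi> | \<pi> permutes I. of_int (sign \<pi>) * (\<Prod>i\<in>I. m (\<pi> i) (f i))) = (0::real)"
    (is "?L = 0")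
proof -
  let ?t = "Transposition.transpose i j"
  have t: "?t permutes I" using assms by (simp add: permutes_swap_id)
  have ft: "f (?t k) = f k" for k using assms by (auto simp: Transposition.transpose_def)
  have "?L = (\<Sum>\<pi> | \<pi> permutes I. of_int (sign (\<pi> \<circ> ?t)) * (\<Prod>k\<in>I. m ((\<pi> \<circ> ?t) k) (f k)))"
    by (rule sum_permutations_compose_right[OF t])
  also have "\<dots> = (\<Sum>\<pi> | \<pi> permutes I. - (of_int (sign \<pi>) * (\<Prod>k\<in>I. m (\<pi> k) (f k))))"
  proof (rule sum.cong[OF refl])
    fix p assume "p \<in> {p. p permutes I}"
    then have p: "p permutes I" by simp
    have "(\<Prod>k\<in>I. m ((p \<circ> ?t) k) (f k)) = (\<Prod>k\<in>I. m (p k) (f k))"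
      using prod.reindex_bij_betw[OF permutes_imp_bij[OF t], of "\<lambda>k. m (p k) (f k)"]
      by (simp add: ft)
    then show "of_int (sign (p \<circ> ?t)) * (\<Prod>k\<in>I. m ((p \<circ> ?t) k) (f k)) =
        - (of_int (sign p) * (\<Prod>k\<in>I. m (p k) (f k)))"
      using assms(4) by (simp add: sign_permutes_compose[OF assms(1) p t] sign_swap_id)
  qed
  also have "\<dots> = - ?L" by (simp add: sum_negf)
  finally show ?thesis by simp
qed

text \<open>An injective self-map of a finite set is a bijection, so the maps that survive are
  exactly the restrictions of permutations; \<open>restrict_id\<close> supplies the identity outside
  \<open>I\<close>.\<close>

lemma sum_PiE_eq_sum_permutes:
  fixes F :: "('i \<Rightarrow> 'i) \<Rightarrow> real"
  assumes "finite I" and "\<And>f. f \<in> I \<rightarrow>\<^sub>E I \<Longrightarrow> \<not> inj_on f I \<Longrightarrow> F f = 0"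
  shows "(\<Sum>f\<in>I \<rightarrow>\<^sub>E I. F f) = (\<Sum>\<pi> | \<pi> permutes I. F (restrict \<pi> I))"
proof -
  have "(\<Sum>f\<in>I \<rightarrow>\<^sub>E I. F f) = (\<Sum>f\<in>{f \<in> I \<rightarrow>\<^sub>E I. inj_on f I}. F f)"
    using assms by (intro sum.mono_neutral_right) (auto simp: finite_PiE)
  also have "\<dots> = (\<Sum>\<pi> | \<pi> permutes I. F (restrict \<pi> I))"
  proof (rule sum.reindex_bij_witness[where i = "\<lambda>p. restrict p I" and j = "\<lambda>f. restrict_id f I"])
    fix f assume "f \<in> {f \<in> I \<rightarrow>\<^sub>E I. inj_on f I}"
    then have f: "f \<in> I \<rightarrow>\<^sub>E I" "inj_on f I" by auto
    then have "f ` I = I" using assms(1) by (intro endo_inj_surj) auto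
    with f have "bij_betw f I I" by (simp add: bij_betw_def)
    then show "restrict_id f I \<in> {p. p permutes I}"
      by (simp add: permutes_restrict_id)
    show "restrict (restrict_id f I) I = f"
      using f by (auto simp: restrict_def PiE_def extensional_def)
    then show "F (restrict (restrict_id f I) I) = F f" by simp
  next
    fix p assume "p \<in> {p. p permutes I}"
    then have p: "p permutes I" by simp
    show "restrict_id (restrict p I) I = p"
      using p by (auto simp: restrict_id_def fun_eq_iff permutes_not_in)
    show "restrict p I \<in> {f \<in> I \<rightarrow>\<^sub>E I. inj_on f I}"
      using p by (auto simp: permutes_in_image permutes_inj_on)
  qed
  finally show ?thesis .
qed

text \<open>The Cauchy--Binet argument behind the multiplicativity of both the determinant and the
  Pfaffian.\<close>

lemma sum_PiE_leibniz_columns: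
  assumes "finite I" and "\<And>f g. (\<And>i. i \<in> I \<Longrightarrow> f i = g i) \<Longrightarrow> c f = c g"
  shows "(\<Sum>\<pi> | \<pi> permutes I. of_int (sign \<pi>) * (\<Sum>f\<in>I \<rightarrow>\<^sub>E I. (\<Prod>i\<in>I. m (\<pi> i) (f i)) * c f)) =
    leibniz_sum I m * (\<Sum>\<pi> | \<pi> permutes I. of_int (sign \<pi>) * c \<pi>)"
proof -
  \<comment> \<open>\<open>R f\<close> is the determinant of the columns of \<open>m\<close>
    selected by \<open>f\<close>: zero if a column repeats, and the determinant of \<open>m\<close>
    times the sign of \<open>f\<close> if \<open>f\<close> is a permutation.\<close>
  define R where "R f = (\<Sum>\<pi> | \<pi> permutes I. of_int (sign \<pi>) * (\<Prod>i\<in>I. m (\<pi> i) (f i)))" for f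
  have "(\<Sum>\<pi> | \<pi> permutes I. of_int (sign \<pi>) * (\<Sum>f\<in>I \<rightarrow>\<^sub>E I. (\<Prod>i\<in>I. m (\<pi> i) (f i)) * c f)) =
      (\<Sum>f\<in>I \<rightarrow>\<^sub>E I. R f * c f)"
    unfolding R_def sum_distrib_left sum_distrib_right
    by (subst sum.swap) (simp add: mult.assoc)
  also have "\<dots> = (\<Sum>p | p permutes I. R (restrict p I) * c (restrict p I))"
  proof (rule sum_PiE_eq_sum_permutes[OF assms(1)])
    fix f :: "'a \<Rightarrow> 'a" assume "\<not> inj_on f I"
    then obtain i j where "i \<in> I" "j \<in> I" "i \<noteq> j" "f i = f j" by (auto simp: inj_on_def)
    then show "R f * c f = 0"
      using leibniz_sum_selected_columns_not_inj[OF assms(1), of i j f m] by (simp add: R_def)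
  qed
  also have "\<dots> = (\<Sum>p | p permutes I. leibniz_sum I m * (of_int (sign p) * c p))"
  proof (rule sum.cong[OF refl])
    fix p assume "p \<in> {p. p permutes I}"
    then have p: "p permutes I" by simp
    have "R (restrict p I) = R p" by (simp add: R_def)
    moreover have "c (restrict p I) = c p" by (rule assms(2)) simp
    ultimately show "R (restrict p I) * c (restrict p I) = leibniz_sum I m * (of_int (sign p) * c p)"
      using leibniz_sum_selected_columns_permutes[OF assms(1) p, of m] by (simp add: R_def)
  qed
  finally show ?thesis by (simp add: sum_distrib_left)
qed

lemma leibniz_sum_mult:
  assumes "finite I"
  shows "leibniz_sum I (\<lambda>i j. \<Sum>k\<in>I. A i k * B k j) = leibniz_sum I A * leibniz_sum I B"
proof -
  \<comment> \<open>Multiplying out chooses a middle index \<open>f i\<close> for each row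
    \<open>i\<close>. The factors of \<open>B\<close> are read as entries of its transpose, the
    shape that the Cauchy-Binet argument expects.\<close>
  have "leibniz_sum I (\<lambda>i j. \<Sum>k\<in>I. A i k * B k j) =
     (\<Sum>\<pi> | \<pi> permutes I. of_int (sign \<pi>) *
       (\<Sum>f\<in>I \<rightarrow>\<^sub>E I. (\<Prod>i\<in>I. B (f i) (\<pi> i)) * (\<Prod>i\<in>I. A i (f i))))"
    unfolding leibniz_sum_def
    by (simp add: prod_sum_PiE assms prod.distrib mult.commute)
  also have "\<dots> = leibniz_sum I (\<lambda>i j. B j i) * leibniz_sum I A"
    by (subst sum_PiE_leibniz_columns[OF assms, where m = "\<lambda>i j. B j i"])
       (auto simp: leibniz_sum_def intro!: prod.cong)
  finally show ?thesis
    by (simp only: leibniz_sum_transpose[OF assms, of B] mult.commute)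
qed

lemma leibniz_sum_congruence:
  assumes "finite I"
  shows "leibniz_sum I (\<lambda>i j. \<Sum>k\<in>I. \<Sum>l\<in>I. m i k * m j l * A k l) =
    (leibniz_sum I m)\<^sup>2 * leibniz_sum I A"
proof -
  have "leibniz_sum I (\<lambda>i j. \<Sum>k\<in>I. \<Sum>l\<in>I. m i k * m j l * A k l) =
      leibniz_sum I (\<lambda>i j. \<Sum>l\<in>I. (\<Sum>k\<in>I. m i k * A k l) * m j l)"
    by (subst sum.swap) (simp add: sum_distrib_right sum_distrib_left ac_simps)
  also have "\<dots> = (leibniz_sum I m)\<^sup>2 * leibniz_sum I A"
    using leibniz_sum_mult[OF assms, of "\<lambda>i l. \<Sum>k\<in>I. m i k * A k l" "\<lambda>l j. m j l"]
    by (simp add: leibniz_sum_mult[OF assms] leibniz_sum_transpose[OF assms, of m] power2_eq_square)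
  finally show ?thesis .
qed

lemma leibniz_sum_zero_row:
  assumes "finite I" "i \<in> I" "\<And>j. j \<in> I \<Longrightarrow> A i j = 0"
  shows "leibniz_sum I A = 0"
  unfolding leibniz_sum_def
proof (rule sum.neutral, safe)
  fix p assume p: "p permutes I"
  have "(\<Prod>i\<in>I. A i (p i)) = 0"
    using assms p by (intro prod_zero bexI[of _ i]) (auto simp: permutes_in_image)
  then show "of_int (sign p) * (\<Prod>i\<in>I. A i (p i)) = 0" by simp
qed

text \<open>A permutation other than the identity moves at least two indices, hence one besides
  \<open>k\<close>, whose row contributes an off-diagonal zero.\<close>

lemma leibniz_sum_row_modified_one:
  assumes "finite I" "k \<in> I"
  shows "leibniz_sum I (\<lambda>i j. if i = k then v j else if i = j then 1 else 0) = v k"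
proof -
  let ?A = "\<lambda>i j. if i = k then v j else if i = j then 1 else 0"
  have "leibniz_sum I ?A = (\<Sum>p\<in>{id}. of_int (sign p) * (\<Prod>i\<in>I. ?A i (p i)))"
    unfolding leibniz_sum_def
  proof (rule sum.mono_neutral_right)
    show "\<forall>p\<in>{p. p permutes I} - {id}. of_int (sign p) * (\<Prod>i\<in>I. ?A i (p i)) = 0"
    proof
      fix p assume "p \<in> {p. p permutes I} - {id}"
      then have p: "p permutes I" "p \<noteq> id" by auto
      have "\<exists>i\<in>I. i \<noteq> k \<and> p i \<noteq> i"
      proof (rule ccontr)
        assume *: "\<not> ?thesis"
        then have "p i = i" if "i \<noteq> k" for i
          using that p by (cases "i \<in> I") (auto simp: permutes_not_in)
        moreover from this have "p k = k"
          using permutes_inj[OF p(1)] by (metis injD)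
        ultimately have "p = id" by (metis eq_id_iff)
        with p show False by simp
      qed
      then obtain i where "i \<in> I" "i \<noteq> k" "p i \<noteq> i" by blast
      then have "i \<in> I" "?A i (p i) = 0" by auto
      then have "(\<Prod>i\<in>I. ?A i (p i)) = 0" using assms(1) by (intro prod_zero) blast+
      then show "of_int (sign p) * (\<Prod>i\<in>I. ?A i (p i)) = 0" by simp
    qed
  qed (auto simp: finite_permutations assms permutes_id)
  also have "\<dots> = (\<Prod>i\<in>I. if i = k then v i else 1)" by (simp cong: prod.cong if_cong)
  also have "\<dots> = v k" using assms by (simp add: prod.delta)
  finally show ?thesis .
qed

text \<open>Multiply \<open>A\<close> from the left by the identity matrix with row \<open>k\<close>
  replaced by \<open>v\<close>: the product has a zero row, while the factor has determinant
  \<open>v k\<close>, which is nonzero.\<close>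

lemma leibniz_sum_eq_0:
  assumes "finite I" "k \<in> I" "v k \<noteq> 0" and ker: "\<And>j. j \<in> I \<Longrightarrow> (\<Sum>i\<in>I. v i * A i j) = 0"
  shows "leibniz_sum I A = 0"
proof -
  let ?C = "\<lambda>i j. if i = k then v j else if i = j then 1 else 0"
  have "leibniz_sum I (\<lambda>i j. \<Sum>l\<in>I. ?C i l * A l j) = 0"
    by (rule leibniz_sum_zero_row[OF assms(1,2)]) (simp add: ker)
  then show ?thesis
    using leibniz_sum_row_modified_one[OF assms(1,2), of v] assms(3)
    by (simp add: leibniz_sum_mult[OF assms(1)])
qed

text \<open>Since \<open>S\<close> and its image under the involution \<open>T\<close> partition \<open>I\<close>, the involution is a
  perfect matching of \<open>I\<close> together with an orientation of its edges.\<close>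

definition oriented_matching :: "'i set \<Rightarrow> 'i set \<Rightarrow> ('i \<Rightarrow> 'i) \<Rightarrow> bool" where
  "oriented_matching I S T \<longleftrightarrow> finite I \<and> S \<subseteq> I \<and> T permutes I \<and> (\<forall>i. T (T i) = i) \<and> T ` S = I - S"

section \<open>Oriented matchings and the congruence law for Pfaffian sums\<close>

lemma oriented_matching_exists:
  assumes "finite I" "card I = 2 * p"
  shows "\<exists>S T. oriented_matching I S T"
proof -
  obtain S where S: "S \<subseteq> I" "card S = p"
    using assms obtain_subset_with_card_n[of p I] by auto
  then have "card (I - S) = card S"
    using assms by (simp add: card_Diff_subset finite_subset)
  then obtain t where t: "bij_betw t S (I - S)"
    using assms(1) S(1) by (metis bij_betw_iff_card finite_Diff finite_subset)
  define T where "T i = (if i \<in> S then t i else if i \<in> I then inv_into S t i else i)" for i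
  have tS: "t i \<in> I - S" if "i \<in> S" for i using t that by (auto simp: bij_betw_def)
  have tI: "inv_into S t i \<in> S" "t (inv_into S t i) = i" if "i \<in> I - S" for i
    using t that by (auto simp: bij_betw_def inv_into_into f_inv_into_f)
  have it: "inv_into S t (t i) = i" if "i \<in> S" for i
    using t that by (auto simp: bij_betw_def)
  have TT: "T (T i) = i" for i
    using tS tI it S unfolding T_def by auto
  have "T ` S = I - S" using t by (auto simp: T_def bij_betw_def)
  moreover have "T permutes I"
  proof (rule bij_imp_permutes)
    show "bij_betw T I I"
      by (rule bij_betwI[where g = T]) (use TT tS tI(1) S in \<open>auto simp: T_def subset_iff\<close>)
  qed (use S in \<open>auto simp: T_def\<close>)
  ultimately show ?thesis using assms(1) S(1) TT unfolding oriented_matching_def by blast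
qed

lemma prod_oriented_matching:
  fixes F :: "'i \<Rightarrow> real"
  assumes "oriented_matching I S T"
  shows "(\<Prod>i\<in>I. F i) = (\<Prod>s\<in>S. F s * F (T s))"
proof -
  have *: "finite I" "S \<subseteq> I" "T ` S = I - S" "inj_on T S"
    using assms by (auto simp: oriented_matching_def permutes_inj_on)
  have "(\<Prod>i\<in>I. F i) = (\<Prod>i\<in>S. F i) * (\<Prod>i\<in>I - S. F i)"
    using * by (metis mult.commute prod.subset_diff)
  also have "(\<Prod>i\<in>I - S. F i) = (\<Prod>s\<in>S. F (T s))"
    using * prod.reindex[of T S F] by simp
  finally show ?thesis by (simp add: prod.distrib)
qed

text \<open>A choice of an index pair for every edge \<open>(s, T s)\<close> is the same as one map
  \<open>f\<close> on all of \<open>I\<close>, with the pair read as \<open>(f s, f (T s))\<close>.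
  This turns a product of double sums into a sum over self-maps of \<open>I\<close>.\<close>

lemma prod_matching_expand:
  fixes m A :: "'i \<Rightarrow> 'i \<Rightarrow> real"
  assumes M: "oriented_matching I S T"
  shows "(\<Prod>s\<in>S. \<Sum>k\<in>I. \<Sum>l\<in>I. m (p s) k * m (p (T s)) l * A k l) =
    (\<Sum>f\<in>I \<rightarrow>\<^sub>E I. (\<Prod>i\<in>I. m (p i) (f i)) * (\<Prod>s\<in>S. A (f s) (f (T s))))"
proof -
  have fin: "finite I" "finite S" "S \<subseteq> I" "T ` S = I - S" "\<And>i. T (T i) = i" "T permutes I"
    using M by (auto simp: oriented_matching_def finite_subset)
  have Tin: "T i \<in> I \<longleftrightarrow> i \<in> I" for i using fin(6) by (rule permutes_in_image)
  have TS: "T i \<in> S" if "i \<in> I" "i \<notin> S" for i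
    using that fin by (metis (no_types, lifting) DiffI imageE)
  have TS': "T i \<notin> S" if "i \<in> S" for i
    using that fin by auto
  have "(\<Prod>s\<in>S. \<Sum>k\<in>I. \<Sum>l\<in>I. m (p s) k * m (p (T s)) l * A k l) =
      (\<Prod>s\<in>S. \<Sum>kl\<in>I \<times> I. m (p s) (fst kl) * m (p (T s)) (snd kl) * A (fst kl) (snd kl))"
    by (simp add: sum.cartesian_product case_prod_beta)
  also have "\<dots> = (\<Sum>g\<in>S \<rightarrow>\<^sub>E I \<times> I. \<Prod>s\<in>S.
      m (p s) (fst (g s)) * m (p (T s)) (snd (g s)) * A (fst (g s)) (snd (g s)))"
    using fin by (simp add: prod_sum_PiE)
  also have "\<dots> = (\<Sum>f\<in>I \<rightarrow>\<^sub>E I. \<Prod>s\<in>S. m (p s) (f s) * m (p (T s)) (f (T s)) * A (f s) (f (T s)))"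
  proof (rule sum.reindex_bij_witness[where
        i = "\<lambda>f. \<lambda>s\<in>S. (f s, f (T s))" and
        j = "\<lambda>g. \<lambda>i\<in>I. if i \<in> S then fst (g i) else snd (g (T i))"])
    fix g :: "'i \<Rightarrow> 'i \<times> 'i" assume g: "g \<in> S \<rightarrow>\<^sub>E I \<times> I"
    then have gI: "fst (g s) \<in> I" "snd (g s) \<in> I" if "s \<in> S" for s
      using that by (auto simp: mem_Times_iff PiE_iff)
    let ?f = "\<lambda>i\<in>I. if i \<in> S then fst (g i) else snd (g (T i))"
    show "(\<lambda>s\<in>S. (?f s, ?f (T s))) = g"
    proof
      fix s show "(\<lambda>s\<in>S. (?f s, ?f (T s))) s = g s"
        using g fin TS' Tin by (cases "s \<in> S") (auto simp: PiE_iff extensional_def)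
    qed
    show "?f \<in> I \<rightarrow>\<^sub>E I" using gI TS by auto
    show "(\<Prod>s\<in>S. m (p s) (?f s) * m (p (T s)) (?f (T s)) * A (?f s) (?f (T s))) =
        (\<Prod>s\<in>S. m (p s) (fst (g s)) * m (p (T s)) (snd (g s)) * A (fst (g s)) (snd (g s)))"
      using fin TS' Tin by (intro prod.cong) auto
  next
    fix f assume f: "f \<in> I \<rightarrow>\<^sub>E I"
    let ?g = "\<lambda>s\<in>S. (f s, f (T s))"
    show "?g \<in> S \<rightarrow>\<^sub>E I \<times> I" using f fin Tin by auto
    show "(\<lambda>i\<in>I. if i \<in> S then fst (?g i) else snd (?g (T i))) = f"
    proof
      fix i show "(\<lambda>i\<in>I. if i \<in> S then fst (?g i) else snd (?g (T i))) i = f i"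
        using f fin TS by (cases "i \<in> I") (auto simp: PiE_iff extensional_def)
    qed
  qed
  also have "\<dots> = (\<Sum>f\<in>I \<rightarrow>\<^sub>E I. (\<Prod>i\<in>I. m (p i) (f i)) * (\<Prod>s\<in>S. A (f s) (f (T s))))"
    by (simp add: prod_oriented_matching[OF M] prod.distrib)
  finally show ?thesis .
qed

text \<open>After the expansion, the weight of a map \<open>f\<close> is the product of
  \<open>A\<close> over the images of the edges, so the Cauchy-Binet argument leaves the determinant
  of \<open>m\<close> times the signed sum of these weights.\<close>

lemma pf_sum_congruence:
  assumes M: "oriented_matching I S T"
  shows "pf_sum I S T (\<lambda>i j. \<Sum>k\<in>I. \<Sum>l\<in>I. m i k * m j l * A k l) =
    leibniz_sum I m * pf_sum I S T A"
proof -
  have fin: "finite I" "S \<subseteq> I" "T permutes I" using M by (auto simp: oriented_matching_def)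
  have c: "(\<Prod>s\<in>S. A (f s) (f (T s))) = (\<Prod>s\<in>S. A (g s) (g (T s)))"
    if "\<And>i. i \<in> I \<Longrightarrow> f i = g i" for f g
    using that fin by (intro prod.cong refl) (auto simp: permutes_in_image subset_iff)
  show ?thesis
    unfolding pf_sum_def prod_matching_expand[OF M]
    by (rule sum_PiE_leibniz_columns[OF fin(1)]) (rule c)
qed

lemma pf_sum_cong:
  assumes M: "oriented_matching I S T" and "\<And>i j. i \<in> I \<Longrightarrow> j \<in> I \<Longrightarrow> A i j = B i j"
  shows "pf_sum I S T A = pf_sum I S T B"
proof -
  have fin: "S \<subseteq> I" "T permutes I" using M by (auto simp: oriented_matching_def)
  then show ?thesis unfolding pf_sum_def
    by (intro sum.cong arg_cong2[where f = "(*)"] prod.cong refl assms(2))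
       (auto simp: permutes_in_image)
qed

section \<open>Positivity of the Pfaffian sum at the standard symplectic form\<close>

lemma sign_oriented_matching_automorphism:
  assumes M: "oriented_matching I S T" and p: "p permutes I"
    and S: "\<And>s. s \<in> S \<Longrightarrow> p s \<in> S" and T: "\<And>s. s \<in> S \<Longrightarrow> p (T s) = T (p s)"
  shows "sign p = 1"
proof -
  have fin: "finite I" "finite S" "S \<subseteq> I" "T ` S = I - S" "\<And>i. T (T i) = i" "T permutes I"
    using M by (auto simp: oriented_matching_def finite_subset)
  have Tout: "T i = i" if "i \<notin> I" for i using fin(6) that by (rule permutes_not_in)
  define \<sigma> where "\<sigma> = restrict_id p S"
  have "p ` S = S"
    using S p fin(2) by (intro endo_inj_surj) (auto simp: permutes_inj_on)
  then have "bij_betw p S S" using p by (auto simp: bij_betw_def permutes_inj_on)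
  then have \<sigma>: "\<sigma> permutes I"
    unfolding \<sigma>_def using fin(3) permutes_restrict_id permutes_subset by blast
  \<comment> \<open>\<open>p\<close> is the product of \<open>\<sigma>\<close>, acting on \<open>S\<close>, and its conjugate by \<open>T\<close>, acting on \<open>I - S\<close>.\<close>
  have "p = (\<sigma> \<circ> T) \<circ> (\<sigma> \<circ> T)"
  proof
    fix i
    have TS: "T s \<notin> S" if "s \<in> S" for s using that fin(4) by auto
    consider "i \<in> S" | s where "s \<in> S" "i = T s" | "i \<notin> I" using fin(3,4) by blast
    then show "p i = ((\<sigma> \<circ> T) \<circ> (\<sigma> \<circ> T)) i"
    proof cases
      case 1
      then show ?thesis using TS fin(5) by (simp add: \<sigma>_def restrict_id_def)
    next
      case 2
      then show ?thesis using TS fin(5) S T by (simp add: \<sigma>_def restrict_id_def)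
    next
      case 3
      then have "i \<notin> S" using fin(3) by auto
      then show ?thesis using 3 permutes_not_in[OF p] by (simp add: \<sigma>_def restrict_id_def Tout)
    qed
  qed
  moreover have "\<sigma> \<circ> T permutes I" using fin(6) \<sigma> by (rule permutes_compose)
  ultimately show ?thesis
    by (simp add: sign_permutes_compose[OF fin(1)])
qed

text \<open>The Gram matrix of the standard symplectic form in which every \<open>s\<close> and
  \<open>T s\<close> form a hyperbolic pair.\<close>

definition matching_form :: "'i set \<Rightarrow> ('i \<Rightarrow> 'i) \<Rightarrow> 'i \<Rightarrow> 'i \<Rightarrow> real" where
  "matching_form S T i j = (if i \<in> S \<and> j = T i then 1 else if j \<in> S \<and> i = T j then -1 else 0)"

lemma matching_form_skew:
  assumes "oriented_matching I S T"
  shows "matching_form S T i j = - matching_form S T j i"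
  using assms by (auto simp: matching_form_def oriented_matching_def)

text \<open>In a nonzero term the permutation carries edges to edges. Undoing the reversal of one
  edge changes both the sign of the permutation and that of one factor; once no edge is reversed,
  the term is \<open>1\<close>. Hence the induction on the number of reversed edges.\<close>

lemma pf_term_matching_form_nonneg:
  assumes M: "oriented_matching I S T" and "p permutes I"
  shows "0 \<le> of_int (sign p) * (\<Prod>s\<in>S. matching_form S T (p s) (p (T s)))"
  using assms(2)
proof (induction "card {s \<in> S. p s \<notin> S}" arbitrary: p rule: less_induct)
  case less
  note p = less.prems
  let ?A = "matching_form S T"
  have fin: "finite I" "finite S" "S \<subseteq> I" "T ` S = I - S" "\<And>i. T (T i) = i" "T permutes I"
    using M by (auto simp: oriented_matching_def finite_subset)
  have TS: "T s \<notin> S" "T s \<in> I" "T s \<noteq> s" if "s \<in> S" for s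
  proof -
    show "T s \<notin> S" "T s \<in> I" using that fin(4) by auto
    then show "T s \<noteq> s" using that by metis
  qed
  consider "\<exists>s\<in>S. ?A (p s) (p (T s)) = 0"
    | "\<forall>s\<in>S. ?A (p s) (p (T s)) \<noteq> 0" "\<forall>s\<in>S. p s \<in> S"
    | s where "\<forall>s\<in>S. ?A (p s) (p (T s)) \<noteq> 0" "s \<in> S" "p s \<notin> S"
    by blast
  then show ?case
  proof cases
    case 1
    then have "(\<Prod>s\<in>S. ?A (p s) (p (T s))) = 0" using fin(2) by (intro prod_zero) auto
    then show ?thesis by simp
  next
    case 2
    have *: "p (T s) = T (p s)" "?A (p s) (p (T s)) = 1" if "s \<in> S" for s
    proof -
      show "p (T s) = T (p s)"
        using 2 that TS by (fastforce simp: matching_form_def split: if_splits)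
      then show "?A (p s) (p (T s)) = 1" using 2 that by (auto simp: matching_form_def)
    qed
    have "sign p = 1"
      by (rule sign_oriented_matching_automorphism[OF M p]) (use 2 * in auto)
    with * show ?thesis by simp
  next
    case 3
    let ?t = "Transposition.transpose s (T s)"
    have t: "?t permutes I" using 3 TS fin by (intro permutes_swap_id) auto
    have pt: "p \<circ> ?t permutes I" using t p by (rule permutes_compose)
    have t1: "?t s = T s" "?t (T s) = s" by simp_all
    have t2: "?t u = u" "?t (T u) = T u" if "u \<in> S" "u \<noteq> s" for u
    proof -
      show "?t u = u" using that TS[of s] 3 by (intro transpose_apply_other) auto
      show "?t (T u) = T u"
        using that TS[of u] 3 fin(5) by (intro transpose_apply_other) metis+
    qed
    have "?A (p s) (p (T s)) \<noteq> 0" using 3 by blast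
    then have "p (T s) \<in> S" using 3(3) by (auto simp: matching_form_def split: if_splits)
    then have "{u \<in> S. (p \<circ> ?t) u \<notin> S} \<subseteq> {u \<in> S. p u \<notin> S} - {s}"
      using t2(1) by force
    also have "\<dots> \<subset> {u \<in> S. p u \<notin> S}" using 3 by blast
    finally have "{u \<in> S. (p \<circ> ?t) u \<notin> S} \<subset> {u \<in> S. p u \<notin> S}" .
    then have "card {u \<in> S. (p \<circ> ?t) u \<notin> S} < card {u \<in> S. p u \<notin> S}"
      using fin(2) by (intro psubset_card_mono) auto
    note IH = less.hyps[OF this pt]
    have "(\<Prod>u\<in>S. ?A ((p \<circ> ?t) u) ((p \<circ> ?t) (T u))) =
        ?A (p (T s)) (p s) * (\<Prod>u\<in>S - {s}. ?A (p u) (p (T u)))"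
      using 3(2) fin(2) t1 t2 by (simp add: prod.remove[of S s])
    also have "\<dots> = - (\<Prod>u\<in>S. ?A (p u) (p (T u)))"
      using 3(2) fin(2) matching_form_skew[OF M, of "p (T s)" "p s"]
      by (simp add: prod.remove[of S s])
    finally show ?thesis
      using IH TS(3)[OF 3(2)] by (simp add: sign_permutes_compose[OF fin(1) p t] sign_swap_id)
  qed
qed

text \<open>No term is negative and the identity contributes \<open>1\<close>. This provides the one
  nonzero value from which nonvanishing spreads to all nondegenerate skew forms by
  congruence.\<close>

lemma pf_sum_matching_form_pos:
  assumes M: "oriented_matching I S T"
  shows "0 < pf_sum I S T (matching_form S T)"
  unfolding pf_sum_def
proof (rule sum_pos2)
  show "finite {p. p permutes I}" using M by (simp add: oriented_matching_def finite_permutations)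
  show "id \<in> {p. p permutes I}" by (simp add: permutes_id)
  show "0 < of_int (sign id) * (\<Prod>s\<in>S. matching_form S T (id s) (id (T s)))"
    by (simp add: matching_form_def)
qed (use pf_term_matching_form_nonneg[OF M] in auto)

section \<open>Congruence of nondegenerate skew forms\<close>

definition nondegenerate_on :: "'a set \<Rightarrow> ('a::real_vector \<Rightarrow> 'a \<Rightarrow> real) \<Rightarrow> bool" where
  "nondegenerate_on V \<omega> \<longleftrightarrow> (\<forall>x\<in>V. x \<noteq> 0 \<longrightarrow> (\<exists>y\<in>V. \<omega> x y \<noteq> 0))"

definition skew_on :: "'a set \<Rightarrow> ('a \<Rightarrow> 'a \<Rightarrow> real) \<Rightarrow> bool" where
  "skew_on V \<omega> \<longleftrightarrow> (\<forall>x\<in>V. \<forall>y\<in>V. \<omega> x y = - \<omega> y x)"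

lemma skew_onD: "skew_on V \<omega> \<Longrightarrow> x \<in> V \<Longrightarrow> y \<in> V \<Longrightarrow> \<omega> x y = - \<omega> y x"
  unfolding skew_on_def by blast

lemma skew_on_self:
  assumes "skew_on V \<omega>" "x \<in> V"
  shows "\<omega> x x = 0"
  using skew_onD[OF assms(1,2,2)] by linarith

lemma hyperbolic_pair_exists:
  assumes "bilinear \<omega>" "subspace V" "nondegenerate_on V \<omega>" "V \<noteq> {0}"
  obtains v w where "v \<in> V" "w \<in> V" "\<omega> v w = 1"
proof -
  obtain v where v: "v \<in> V" "v \<noteq> 0" using assms subspace_0 by blast
  then obtain y where y: "y \<in> V" "\<omega> v y \<noteq> 0"
    using assms(3) unfolding nondegenerate_on_def by blast
  then have "\<omega> v (y /\<^sub>R \<omega> v y) = 1"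
    using assms(1) by (simp add: bilinear_rmul)
  then show thesis using that v y assms(2) by (metis subspace_scale)
qed

text \<open>The plane spanned by \<open>v\<close> and \<open>w\<close> splits off as a direct
  summand; the last claim gives the projection onto its symplectic complement.\<close>

lemma hyperbolic_pair_complement:
  fixes V :: "'a::euclidean_space set"
  assumes bil: "bilinear \<omega>" and V: "subspace V" and sk: "skew_on V \<omega>" and nd: "nondegenerate_on V \<omega>"
    and vw: "v \<in> V" "w \<in> V" "\<omega> v w = 1"
  defines "U \<equiv> {x \<in> V. \<omega> v x = 0 \<and> \<omega> w x = 0}"
  shows "subspace U" "skew_on U \<omega>" "nondegenerate_on U \<omega>" "dim V = dim U + 2"
    "x \<in> V \<Longrightarrow> x - \<omega> x w *\<^sub>R v + \<omega> x v *\<^sub>R w \<in> U"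
proof -
  note bl = bilinear_ladd[OF bil] bilinear_radd[OF bil] bilinear_lmul[OF bil] bilinear_rmul[OF bil]
    bilinear_lsub[OF bil] bilinear_rsub[OF bil] bilinear_rzero[OF bil] bilinear_lzero[OF bil]
  have vv: "\<omega> v v = 0" "\<omega> w w = 0" "\<omega> w v = -1"
    using skew_on_self[OF sk vw(1)] skew_on_self[OF sk vw(2)] skew_onD[OF sk vw(2,1)] vw(3) by auto
  have sw: "\<omega> x y = - \<omega> y x" if "x \<in> V" "y \<in> V" for x y
    using sk that by (rule skew_onD)
  show U: "subspace U"
    using V unfolding U_def subspace_def by (auto simp: bl)
  show "skew_on U \<omega>" using sk unfolding skew_on_def U_def by blast
  show dec: "x - \<omega> x w *\<^sub>R v + \<omega> x v *\<^sub>R w \<in> U" if "x \<in> V" for x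
    using that V vw vv sw[of v x] sw[of w x] unfolding U_def
    by (auto simp: bl intro: subspace_add subspace_diff subspace_scale)
  show "nondegenerate_on U \<omega>"
    unfolding nondegenerate_on_def
  proof (intro ballI impI)
    fix x assume x: "x \<in> U" "x \<noteq> 0"
    then have xV: "x \<in> V" "\<omega> v x = 0" "\<omega> w x = 0" by (auto simp: U_def)
    then obtain y where y: "y \<in> V" "\<omega> x y \<noteq> 0" using nd x unfolding nondegenerate_on_def by blast
    \<comment> \<open>Pairing with \<open>x\<close> ignores the plane, so a witness in
      \<open>V\<close> may be replaced by its component in \<open>U\<close>.\<close>
    have "\<omega> x (y - \<omega> y w *\<^sub>R v + \<omega> y v *\<^sub>R w) = \<omega> x y"
      using xV vw sw[of x v] sw[of x w] by (simp add: bl)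
    then show "\<exists>y\<in>U. \<omega> x y \<noteq> 0" using dec[OF y(1)] y(2) by metis
  qed
  let ?P = "span {v, w}"
  have "w \<notin> span {v}"
  proof
    assume "w \<in> span {v}"
    then obtain c where "w = c *\<^sub>R v" by (auto simp: span_singleton)
    then show False using vw vv by (simp add: bl)
  qed
  moreover have "v \<noteq> 0" using vw by (auto simp: bl)
  ultimately have "dim ?P = 2" by (simp add: insert_commute[of v w] dim_insert)
  moreover have "?P \<inter> U = {0}"
  proof -
    have "x = 0" if xPU: "x \<in> ?P" "x \<in> U" for x
    proof -
      obtain a b where x: "x = a *\<^sub>R v + b *\<^sub>R w"
      proof -
        obtain a where "x - a *\<^sub>R v \<in> span {w}" using xPU(1) by (auto simp: span_insert)
        then obtain b where "x - a *\<^sub>R v = b *\<^sub>R w" by (auto simp: span_singleton)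
        then show thesis by (intro that[of a b]) (simp add: algebra_simps)
      qed
      have "\<omega> v x = 0" "\<omega> w x = 0" using xPU(2) by (auto simp: U_def)
      then show "x = 0" using vw vv by (simp add: x bl)
    qed
    then show ?thesis using U by (auto simp: subspace_0 span_zero)
  qed
  moreover have "{x + y |x y. x \<in> ?P \<and> y \<in> U} = V"
  proof
    have "?P \<subseteq> V" using vw V by (intro span_minimal) auto
    then show "{x + y |x y. x \<in> ?P \<and> y \<in> U} \<subseteq> V"
      using V by (auto simp: U_def intro: subspace_add)
    show "V \<subseteq> {x + y |x y. x \<in> ?P \<and> y \<in> U}"
    proof
      fix x assume "x \<in> V"
      have "\<omega> x w *\<^sub>R v - \<omega> x v *\<^sub>R w \<in> ?P"
        by (auto intro: span_diff span_scale span_base)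
      moreover have "x = (\<omega> x w *\<^sub>R v - \<omega> x v *\<^sub>R w) + (x - \<omega> x w *\<^sub>R v + \<omega> x v *\<^sub>R w)" by simp
      ultimately show "x \<in> {x + y |x y. x \<in> ?P \<and> y \<in> U}" using dec[OF \<open>x \<in> V\<close>] by blast
    qed
  qed
  ultimately show "dim V = dim U + 2"
    using dim_sums_Int[OF subspace_span[of "{v, w}"] U] by (simp add: add.commute)
qed

text \<open>Splitting off one hyperbolic pair on each side leaves complements of equal, smaller
  dimension, to which the induction hypothesis applies.\<close>

lemma nondegenerate_skew_forms_congruent:
  fixes V :: "'a::euclidean_space set" and W :: "'b::euclidean_space set"
  assumes "bilinear \<omega>" "subspace V" "skew_on V \<omega>" "nondegenerate_on V \<omega>"
    and "bilinear \<eta>" "subspace W" "skew_on W \<eta>" "nondegenerate_on W \<eta>"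
    and "dim V = dim W"
  shows "\<exists>M. linear M \<and> (\<forall>x\<in>V. M x \<in> W) \<and> (\<forall>x\<in>V. \<forall>y\<in>V. \<omega> x y = \<eta> (M x) (M y))"
  using assms
proof (induction "dim V" arbitrary: V W rule: less_induct)
  case less
  note bil = \<open>bilinear \<omega>\<close> \<open>bilinear \<eta>\<close>
  note bl = bilinear_ladd[OF bil(1)] bilinear_radd[OF bil(1)] bilinear_lmul[OF bil(1)]
    bilinear_rmul[OF bil(1)] bilinear_lsub[OF bil(1)] bilinear_rsub[OF bil(1)]
    bilinear_ladd[OF bil(2)] bilinear_radd[OF bil(2)] bilinear_lmul[OF bil(2)]
    bilinear_rmul[OF bil(2)] bilinear_lsub[OF bil(2)] bilinear_rsub[OF bil(2)]
  show ?case
  proof (cases "V = {0}")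
    case True
    then show ?thesis
      using bil less.prems(6) by (intro exI[of _ "\<lambda>_. 0"])
        (auto simp: linear_zero subspace_0 bilinear_lzero)
  next
    case False
    then have "dim V \<noteq> 0" using subspace_0[OF less.prems(2)] by auto
    then have W0: "W \<noteq> {0}" using less.prems(9) by auto
    obtain v w where vw: "v \<in> V" "w \<in> V" "\<omega> v w = 1"
      using hyperbolic_pair_exists[OF less.prems(1,2,4) False] .
    obtain v' w' where vw': "v' \<in> W" "w' \<in> W" "\<eta> v' w' = 1"
      using hyperbolic_pair_exists[OF less.prems(5,6,8) W0] .
    define U where "U = {x \<in> V. \<omega> v x = 0 \<and> \<omega> w x = 0}"
    define U' where "U' = {x \<in> W. \<eta> v' x = 0 \<and> \<eta> w' x = 0}"
    note hU = hyperbolic_pair_complement[OF less.prems(1-4) vw, folded U_def]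
    note hU' = hyperbolic_pair_complement[OF less.prems(5-8) vw', folded U'_def]
    obtain N where N: "linear N" "\<forall>x\<in>U. N x \<in> U'" "\<forall>x\<in>U. \<forall>y\<in>U. \<omega> x y = \<eta> (N x) (N y)"
      using less.hyps[of U U'] hU(1-4) hU'(1-4) bil less.prems(9) by auto
    \<comment> \<open>\<open>u\<close> projects onto the complement \<open>U\<close>;
      \<open>M\<close> acts there as \<open>N\<close> and sends \<open>v\<close> to
      \<open>v'\<close> and \<open>w\<close> to \<open>w'\<close>.\<close>
    define u where "u x = x - \<omega> x w *\<^sub>R v + \<omega> x v *\<^sub>R w" for x
    define M where "M x = N (u x) + \<omega> x w *\<^sub>R v' - \<omega> x v *\<^sub>R w'" for x
    have "linear u"
      by (rule linearI) (auto simp: u_def bl algebra_simps)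
    then have "linear (\<lambda>x. N (u x))" using N(1) linear_compose[of u N] by (simp add: o_def)
    then have "linear M"
      unfolding M_def
      by (intro linearI)
        (simp_all add: bl linear_add[of "\<lambda>x. N (u x)"] linear_cmul[of "\<lambda>x. N (u x)"] algebra_simps)
    moreover have uU: "u x \<in> U" if "x \<in> V" for x using hU(5)[OF that] by (simp add: u_def)
    have NW: "N (u x) \<in> W" "\<eta> v' (N (u x)) = 0" "\<eta> w' (N (u x)) = 0"
        "\<eta> (N (u x)) v' = 0" "\<eta> (N (u x)) w' = 0" if "x \<in> V" for x
    proof -
      have "N (u x) \<in> U'" using N(2) uU[OF that] by blast
      then show *: "N (u x) \<in> W" "\<eta> v' (N (u x)) = 0" "\<eta> w' (N (u x)) = 0" by (auto simp: U'_def)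
      show "\<eta> (N (u x)) v' = 0" "\<eta> (N (u x)) w' = 0"
        using * skew_onD[OF less.prems(7) *(1) vw'(1)] skew_onD[OF less.prems(7) *(1) vw'(2)] by auto
    qed
    have "M x \<in> W" if "x \<in> V" for x
      unfolding M_def using NW[OF that] vw' less.prems(6)
      by (intro subspace_add subspace_diff subspace_scale) auto
    moreover have "\<omega> x y = \<eta> (M x) (M y)" if "x \<in> V" "y \<in> V" for x y
    proof -
      have sw: "\<omega> v v = 0" "\<omega> w w = 0" "\<omega> w v = -1" "\<eta> v' v' = 0" "\<eta> w' w' = 0" "\<eta> w' v' = -1"
        using skew_on_self[OF less.prems(3)] skew_on_self[OF less.prems(7)] vw vw'
          skew_onD[OF less.prems(3) vw(2,1)] skew_onD[OF less.prems(7) vw'(2,1)] by auto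
      have sw': "\<omega> v y = - \<omega> y v" "\<omega> w y = - \<omega> y w" 
        using skew_onD[OF less.prems(3) _ that(2)] vw by auto
      have "\<omega> (u x) (u y) = \<eta> (N (u x)) (N (u y))" using N(3) uU that by blast
      moreover have "\<omega> (u x) (u y) = \<omega> x y - \<omega> x v * \<omega> y w + \<omega> x w * \<omega> y v"
        unfolding u_def by (simp add: bl sw sw' vw(3) algebra_simps)
      moreover have "\<eta> (M x) (M y) = \<eta> (N (u x)) (N (u y)) - \<omega> x w * \<omega> y v + \<omega> x v * \<omega> y w"
        unfolding M_def by (simp add: bl sw vw'(3) NW that algebra_simps)
      ultimately show ?thesis by simp
    qed
    ultimately show ?thesis by blast
  qed
qed

section \<open>The Pfaffian of a skew form\<close>

lemma bilinear_compose:
  assumes "bilinear \<omega>" "linear f" "linear g"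
  shows "bilinear (\<lambda>x y. \<omega> (f x) (g y))"
  using assms unfolding bilinear_def
  by (auto simp: linear_iff)

lemma bilinear_inner: "bilinear (\<lambda>x y::'a::euclidean_space. x \<bullet> y)"
  unfolding bilinear_def by (auto simp: linear_iff inner_add algebra_simps)

lemma bilinear_apply_inner:
  fixes f :: "'a::euclidean_space \<Rightarrow> 'b::euclidean_space"
  assumes "linear f"
  shows "bilinear (\<lambda>x y. f x \<bullet> y)"
  using bilinear_compose[OF bilinear_inner assms linear_id] by simp

lemma bilinear_inner_const:
  fixes h :: "'a::real_vector \<Rightarrow> 'b::real_vector \<Rightarrow> 'c::euclidean_space"
  assumes "bilinear h"
  shows "bilinear (\<lambda>x y. h x y \<bullet> z)"
  using assms unfolding bilinear_def
  by (auto simp: linear_iff inner_left_distrib)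

lemma bilinear_linear_combination:
  fixes \<omega> \<eta> :: "'a::real_vector \<Rightarrow> 'b::real_vector \<Rightarrow> real"
  assumes "bilinear \<omega>" "bilinear \<eta>"
  shows "bilinear (\<lambda>x y. c * \<omega> x y + d * \<eta> x y)"
  using assms unfolding bilinear_def
  by (auto simp: linear_iff algebra_simps)

text \<open>The basis serves as index set of Gram matrices; the oriented matching on it fixes the
  sign of the Pfaffian sum and forces the dimension to be even.\<close>

locale matched_orthonormal_basis =
  fixes V b S :: "'a::euclidean_space set" and T :: "'a \<Rightarrow> 'a"
  assumes orth: "pairwise orthogonal b"
    and unit: "\<And>x. x \<in> b \<Longrightarrow> norm x = 1"
    and span_b: "span b = V"
    and matching: "oriented_matching b S T"
begin

abbreviation "fdet \<equiv> leibniz_sum b"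
abbreviation "pf \<equiv> pf_sum b S T"

lemma finite_b: "finite b"
  using matching by (simp add: oriented_matching_def)

lemma subspace_V: "subspace V"
  using span_b by (metis subspace_span)

lemma b_in_V: "k \<in> b \<Longrightarrow> k \<in> V"
  using span_b by (metis span_base)

lemma inner_b: "k \<in> b \<Longrightarrow> l \<in> b \<Longrightarrow> k \<bullet> l = (if k = l then 1 else 0)"
  using orth unit by (auto simp: pairwise_def orthogonal_def norm_eq_1)

definition proj :: "'a \<Rightarrow> 'a" where
  "proj x = (\<Sum>k\<in>b. (x \<bullet> k) *\<^sub>R k)"

lemma linear_proj: "linear proj"
  unfolding proj_def
  by (intro linearI) (auto simp: inner_add sum.distrib scaleR_add_left scaleR_sum_right)

lemma proj_in_V: "proj x \<in> V"
  unfolding proj_def by (intro subspace_sum[OF subspace_V] subspace_scale[OF subspace_V] b_in_V)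

lemma proj_V: assumes "x \<in> V" shows "proj x = x"
proof -
  have "proj x = id x"
  proof (rule linear_eq_on_span[OF linear_proj linear_id])
    fix k assume "k \<in> b"
    then have "proj k = (\<Sum>l\<in>b. if l = k then k else 0)"
      unfolding proj_def by (intro sum.cong) (auto simp: inner_b)
    then show "proj k = id k" using \<open>k \<in> b\<close> finite_b by simp
  qed (use assms span_b in auto)
  then show ?thesis by simp
qed

lemma proj_orthogonal:
  assumes "x \<in> orthogonal_comp V"
  shows "proj x = 0"
  unfolding proj_def using assms b_in_V
  by (intro sum.neutral) (auto simp: orthogonal_comp_def orthogonal_def inner_commute)

lemma bilinear_expand:
  fixes \<omega> :: "'a \<Rightarrow> 'a \<Rightarrow> real"
  assumes "bilinear \<omega>" "x \<in> V" "y \<in> V"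
  shows "\<omega> x y = (\<Sum>k\<in>b. \<Sum>l\<in>b. (x \<bullet> k) * (y \<bullet> l) * \<omega> k l)"
proof -
  have "\<omega> x y = \<omega> (proj x) (proj y)" using assms proj_V by simp
  also have "\<dots> = (\<Sum>k\<in>b. \<Sum>l\<in>b. (x \<bullet> k) * (y \<bullet> l) * \<omega> k l)"
    unfolding proj_def
    by (simp add: bilinear_sum[OF assms(1)] bilinear_lmul[OF assms(1)] bilinear_rmul[OF assms(1)]
      sum.cartesian_product[symmetric] mult.assoc mult.left_commute)
  finally show ?thesis .
qed

lemma pf_cong: "(\<And>x y. x \<in> V \<Longrightarrow> y \<in> V \<Longrightarrow> \<omega> x y = \<eta> x y) \<Longrightarrow> pf \<omega> = pf \<eta>"
  by (rule pf_sum_cong[OF matching]) (auto dest: b_in_V)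

lemma fdet_cong: "(\<And>x y. x \<in> V \<Longrightarrow> y \<in> V \<Longrightarrow> \<omega> x y = \<eta> x y) \<Longrightarrow> fdet \<omega> = fdet \<eta>"
  by (rule leibniz_sum_cong) (auto dest: b_in_V)

lemma pf_congruence:
  assumes "bilinear \<omega>" "\<And>x. x \<in> V \<Longrightarrow> M x \<in> V"
    and "\<And>x y. x \<in> V \<Longrightarrow> y \<in> V \<Longrightarrow> \<eta> x y = \<omega> (M x) (M y)"
  shows "pf \<eta> = fdet (\<lambda>x y. M x \<bullet> y) * pf \<omega>"
proof -
  have "pf \<eta> = pf (\<lambda>x y. \<Sum>k\<in>b. \<Sum>l\<in>b. (M x \<bullet> k) * (M y \<bullet> l) * \<omega> k l)"
    using assms by (intro pf_cong) (simp add: bilinear_expand)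
  then show ?thesis by (simp add: pf_sum_congruence[OF matching])
qed

lemma fdet_congruence:
  assumes "bilinear \<omega>" "\<And>x. x \<in> V \<Longrightarrow> M x \<in> V"
    and "\<And>x y. x \<in> V \<Longrightarrow> y \<in> V \<Longrightarrow> \<eta> x y = \<omega> (M x) (M y)"
  shows "fdet \<eta> = (fdet (\<lambda>x y. M x \<bullet> y))\<^sup>2 * fdet \<omega>"
proof -
  have "fdet \<eta> = fdet (\<lambda>x y. \<Sum>k\<in>b. \<Sum>l\<in>b. (M x \<bullet> k) * (M y \<bullet> l) * \<omega> k l)"
    using assms by (intro fdet_cong) (simp add: bilinear_expand)
  then show ?thesis by (simp add: leibniz_sum_congruence[OF finite_b])
qed

lemma fdet_degenerate:
  assumes bil: "bilinear \<omega>" and v: "v \<in> V" "v \<noteq> 0" "\<And>y. y \<in> V \<Longrightarrow> \<omega> v y = 0"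
  shows "fdet \<omega> = 0"
proof -
  have "(\<Sum>k\<in>b. (v \<bullet> k) *\<^sub>R k) \<noteq> 0" using v proj_V by (simp add: proj_def)
  then obtain k where "k \<in> b" "(v \<bullet> k) *\<^sub>R k \<noteq> 0" by (rule sum.not_neutral_contains_not_neutral)
  then have k: "k \<in> b" "v \<bullet> k \<noteq> 0" by auto
  show ?thesis
  \<comment> \<open>The coordinates of the radical vector \<open>v\<close> form a left kernel vector
    of the Gram matrix.\<close>
  proof (rule leibniz_sum_eq_0[of b k "\<lambda>i. v \<bullet> i" \<omega>])
    fix j assume j: "j \<in> b"
    have "(\<Sum>i\<in>b. (v \<bullet> i) * \<omega> i j) = \<omega> (proj v) j"
    proof -
      interpret l: linear "\<lambda>x. \<omega> x j" using bil by (simp add: bilinear_def)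
      show ?thesis by (simp add: proj_def l.sum l.scale)
    qed
    then show "(\<Sum>i\<in>b. (v \<bullet> i) * \<omega> i j) = 0" using v j b_in_V proj_V by simp
  qed (use k finite_b in auto)
qed

text \<open>A form with \<open>v\<close> in its radical is unchanged by pulling it back along the projection that
  kills \<open>v\<close>, and that projection has determinant \<open>0\<close>.\<close>

lemma pf_degenerate:
  assumes bil: "bilinear \<omega>" and sk: "skew_on V \<omega>"
    and v: "v \<in> V" "v \<noteq> 0" "\<And>y. y \<in> V \<Longrightarrow> \<omega> v y = 0"
  shows "pf \<omega> = 0"
proof -
  define M where "M x = x - ((x \<bullet> v) / (v \<bullet> v)) *\<^sub>R v" for x
  have M: "M x \<in> V" if "x \<in> V" for x
    unfolding M_def using v(1) that by (intro subspace_diff subspace_scale subspace_V)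
  have "linear M"
    unfolding M_def by (intro linearI) (auto simp: inner_add add_divide_distrib algebra_simps)
  then have "fdet (\<lambda>x y. M x \<bullet> y) = 0"
    using v(1,2) by (intro fdet_degenerate[of _ v] bilinear_apply_inner \<open>linear M\<close>) (auto simp: M_def)
  moreover have "\<omega> x v = 0" if "x \<in> V" for x
    using skew_onD[OF sk that v(1)] v(3)[OF that] by simp
  then have "\<omega> x y = \<omega> (M x) (M y)" if "x \<in> V" "y \<in> V" for x y
    unfolding M_def using v that
    by (simp add: bilinear_lsub[OF bil] bilinear_rsub[OF bil] bilinear_lmul[OF bil] bilinear_rmul[OF bil])
  then have "pf \<omega> = fdet (\<lambda>x y. M x \<bullet> y) * pf \<omega>"
    using M by (intro pf_congruence[OF bil])
  ultimately show ?thesis by simp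
qed

lemma skew_form_nonzero_pf_exists:
  obtains \<omega> where "bilinear \<omega>" "skew_on V \<omega>" "pf \<omega> \<noteq> 0"
proof
  let ?A = "matching_form S T"
  let ?w = "\<lambda>x y. \<Sum>k\<in>b. \<Sum>l\<in>b. (x \<bullet> k) * (y \<bullet> l) * ?A k l"
  show "bilinear ?w"
    unfolding bilinear_def
    by (auto simp: linear_iff inner_add sum.distrib sum_distrib_left algebra_simps)
  show "skew_on V ?w"
    unfolding skew_on_def
  proof (intro ballI)
    fix x y
    have "?w x y = (\<Sum>l\<in>b. \<Sum>k\<in>b. (x \<bullet> k) * (y \<bullet> l) * ?A k l)" by (rule sum.swap)
    also have "\<dots> = (\<Sum>l\<in>b. \<Sum>k\<in>b. - ((y \<bullet> l) * (x \<bullet> k) * ?A l k))"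
      by (intro sum.cong refl) (subst matching_form_skew[OF matching], simp)
    also have "\<dots> = - ?w y x" by (simp add: sum_negf)
    finally show "?w x y = - ?w y x" .
  qed
  have "?w i j = ?A i j" if "i \<in> b" "j \<in> b" for i j
  proof -
    have "?w i j = (\<Sum>k\<in>b. \<Sum>l\<in>b. if k = i then if l = j then ?A k l else 0 else 0)"
      using that by (intro sum.cong refl) (auto simp: inner_b)
    also have "\<dots> = (\<Sum>k\<in>b. if k = i then \<Sum>l\<in>b. if l = j then ?A k l else 0 else 0)"
      by (intro sum.cong refl) auto
    also have "\<dots> = ?A i j" using that finite_b by simp
    finally show ?thesis .
  qed
  then have "pf ?w = pf ?A" by (intro pf_sum_cong[OF matching])
  then show "pf ?w \<noteq> 0" using pf_sum_matching_form_pos[OF matching] by simp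
qed

text \<open>Some skew form \<open>\<eta>\<close> has nonzero Pfaffian sum. It is nondegenerate,
  hence a pullback of \<open>\<omega>\<close>, and the congruence law makes
  \<open>pf \<omega>\<close> a factor of \<open>pf \<eta>\<close>.\<close>

lemma pf_nonzero:
  assumes bil: "bilinear \<omega>" and sk: "skew_on V \<omega>" and nd: "nondegenerate_on V \<omega>"
  shows "pf \<omega> \<noteq> 0"
proof -
  obtain \<eta> where \<eta>: "bilinear \<eta>" "skew_on V \<eta>" "pf \<eta> \<noteq> 0"
    using skew_form_nonzero_pf_exists .
  have "nondegenerate_on V \<eta>"
    using pf_degenerate[OF \<eta>(1,2)] \<eta>(3) unfolding nondegenerate_on_def by blast
  then obtain M where M: "\<forall>x\<in>V. M x \<in> V" "\<forall>x\<in>V. \<forall>y\<in>V. \<eta> x y = \<omega> (M x) (M y)"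
    using nondegenerate_skew_forms_congruent[of \<eta> V \<omega> V] \<eta> assms subspace_V by blast
  then have "pf \<eta> = fdet (\<lambda>x y. M x \<bullet> y) * pf \<omega>"
    by (intro pf_congruence[OF bil]) auto
  then show ?thesis using \<eta>(3) by auto
qed

text \<open>Pulling back along \<open>M\<close> multiplies \<open>pf\<close> by the determinant of
  \<open>M\<close> and \<open>fdet\<close> by its square; on degenerate forms both vanish. So the
  ratio of \<open>(pf \<omega>)\<^sup>2\<close> to \<open>fdet \<omega>\<close> is that of the
  reference form \<open>\<eta>\<close>.\<close>

lemma pf_squared:
  assumes bil: "bilinear \<omega>" and sk: "skew_on V \<omega>"
    and \<eta>: "bilinear \<eta>" "skew_on V \<eta>" "nondegenerate_on V \<eta>"
  shows "(pf \<omega>)\<^sup>2 * fdet \<eta> = (pf \<eta>)\<^sup>2 * fdet \<omega>"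
proof (cases "nondegenerate_on V \<omega>")
  case True
  then obtain M where M: "\<forall>x\<in>V. M x \<in> V" "\<forall>x\<in>V. \<forall>y\<in>V. \<omega> x y = \<eta> (M x) (M y)"
    using nondegenerate_skew_forms_congruent[of \<omega> V \<eta> V] \<eta> assms subspace_V by blast
  have "pf \<omega> = fdet (\<lambda>x y. M x \<bullet> y) * pf \<eta>"
    using M by (intro pf_congruence[OF \<eta>(1)]) auto
  moreover have "fdet \<omega> = (fdet (\<lambda>x y. M x \<bullet> y))\<^sup>2 * fdet \<eta>"
    using M by (intro fdet_congruence[OF \<eta>(1)]) auto
  ultimately show ?thesis by (simp add: power_mult_distrib)
next
  case False
  then obtain v where "v \<in> V" "v \<noteq> 0" "\<forall>y\<in>V. \<omega> v y = 0" unfolding nondegenerate_on_def by blast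
  then show ?thesis using pf_degenerate[OF bil sk] fdet_degenerate[OF bil] by simp
qed

end

section \<open>Complex structures and the positivity of complex-linear determinants\<close>

locale hermitian_matched_basis = matched_orthonormal_basis +
  fixes J :: "'a \<Rightarrow> 'a"
  assumes linear_J: "linear J" and J_J: "\<And>x. J (J x) = - x"
    and J_isometry: "\<And>x y. J x \<bullet> J y = x \<bullet> y"
    and J_V: "\<And>x. x \<in> V \<Longrightarrow> J x \<in> V"
begin

lemma J_inner: "J x \<bullet> y = - (x \<bullet> J y)"
  using J_isometry[of "J x" y] by (simp add: J_J)

lemma bilinear_J: "bilinear (\<lambda>x y. J x \<bullet> y)"
  by (rule bilinear_apply_inner[OF linear_J])

lemma skew_J: "skew_on V (\<lambda>x y. J x \<bullet> y)"
  unfolding skew_on_def by (metis J_inner inner_commute)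

lemma nondegenerate_J: "nondegenerate_on V (\<lambda>x y. J x \<bullet> y)"
  unfolding nondegenerate_on_def by (metis J_V J_isometry inner_eq_zero_iff)

lemma pf_J_nonzero: "pf (\<lambda>x y. J x \<bullet> y) \<noteq> 0"
  by (rule pf_nonzero[OF bilinear_J skew_J nondegenerate_J])

text \<open>\<open>J\<close> preserves the form \<open>\<langle>Jx, y\<rangle>\<close>.\<close>

lemma fdet_J: "fdet (\<lambda>x y. J x \<bullet> y) = 1"
proof -
  have "pf (\<lambda>x y. J x \<bullet> y) = fdet (\<lambda>x y. J x \<bullet> y) * pf (\<lambda>x y. J x \<bullet> y)"
    by (rule pf_congruence[OF bilinear_J]) (auto simp: J_V J_isometry)
  then show ?thesis using pf_J_nonzero by simp
qed

text \<open>The segment from \<open>\<langle>Jx, y\<rangle>\<close> to its pullback along \<open>a\<close> stays inside the nondegenerate forms,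
  because pairing \<open>x\<close> with \<open>Jx\<close> gives a convex combination of \<open>\<bar>x\<bar>\<^sup>2\<close> and \<open>\<bar>a x\<bar>\<^sup>2\<close>.\<close>

lemma fdet_complex_linear_pos:
  assumes a: "linear a" "\<And>x. x \<in> V \<Longrightarrow> a x \<in> V" "\<And>x. x \<in> V \<Longrightarrow> a x = 0 \<Longrightarrow> x = 0"
    and aJ: "\<And>x. x \<in> V \<Longrightarrow> a (J x) = J (a x)"
  shows "0 < fdet (\<lambda>x y. a x \<bullet> y)"
proof -
  let ?J = "\<lambda>x y. J x \<bullet> y"
  let ?w = "\<lambda>t x y. (1 - t) * (J x \<bullet> y) + t * (J (a x) \<bullet> a y)"
  have bil: "bilinear (?w t)" for t
    by (intro bilinear_linear_combination bilinear_J bilinear_compose[OF bilinear_J] a)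
  have sk: "skew_on V (?w t)" for t
    unfolding skew_on_def
  proof (intro ballI)
    fix x y
    have "J x \<bullet> y = - (J y \<bullet> x)" "J (a x) \<bullet> a y = - (J (a y) \<bullet> a x)"
      by (metis J_inner inner_commute)+
    then show "?w t x y = - ?w t y x" by (simp add: algebra_simps)
  qed
  have nd: "nondegenerate_on V (?w t)" if "0 \<le> t" "t \<le> 1" for t
    unfolding nondegenerate_on_def
  proof (intro ballI impI)
    fix x assume x: "x \<in> V" "x \<noteq> 0"
    then have "0 < x \<bullet> x" "0 < a x \<bullet> a x" using a(3) by auto
    then have "0 < (1 - t) * (x \<bullet> x) + t * (a x \<bullet> a x)"
      using that by (cases "t = 0") (auto intro: add_nonneg_pos)
    then have "?w t x (J x) \<noteq> 0" using x by (simp add: aJ J_isometry)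
    then show "\<exists>y\<in>V. ?w t x y \<noteq> 0" using J_V[OF x(1)] by blast
  qed
  \<comment> \<open>Dividing by the value at \<open>t = 0\<close> makes \<open>F\<close> start at
    \<open>1\<close> whatever the sign of that value; by the congruence law \<open>F\<close> ends at
    the determinant of \<open>a\<close>. A nonpositive end value would force a zero in
    between.\<close>
  define F where "F t = pf (?w t) / pf ?J" for t
  have "F 0 = 1" using pf_J_nonzero by (simp add: F_def)
  have "pf (?w 1) = fdet (\<lambda>x y. a x \<bullet> y) * pf ?J"
    by (rule pf_congruence[OF bilinear_J]) (auto simp: a)
  then have F1: "F 1 = fdet (\<lambda>x y. a x \<bullet> y)" using pf_J_nonzero by (simp add: F_def)
  have cont: "continuous_on {0..1} F"
    unfolding F_def pf_sum_def
    by (intro continuous_intros ballI) (use pf_J_nonzero in \<open>simp add: pf_sum_def\<close>)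
  show ?thesis
  proof (rule ccontr)
    assume "\<not> ?thesis"
    then obtain t where "0 \<le> t" "t \<le> 1" "F t = 0"
      using IVT2'[of F 1 0 0] cont \<open>F 0 = 1\<close> F1 by auto
    then show False using pf_nonzero[OF bil sk nd] pf_J_nonzero by (auto simp: F_def)
  qed
qed

end

section \<open>The Pfaffian as a polynomial square root\<close>

lemma so_on_eqI:
  assumes "subspace V" "B \<in> so_on V" "C \<in> so_on V"
    and eq: "\<And>x y. x \<in> V \<Longrightarrow> y \<in> V \<Longrightarrow> blinfun_apply B x \<bullet> y = blinfun_apply C x \<bullet> y"
  shows "B = C"
proof (rule blinfun_eqI)
  fix z
  obtain x y where xy: "x \<in> span V" "\<And>w. w \<in> span V \<Longrightarrow> orthogonal y w" "z = x + y"
    using orthogonal_subspace_decomp_exists[of V z] by metis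
  have x: "x \<in> V" using xy(1) assms(1) by (simp add: span_eq_iff[THEN iffD2])
  have y: "y \<in> orthogonal_comp V"
    using xy(2) by (auto simp: orthogonal_comp_def orthogonal_commute span_base)
  have "blinfun_apply B x = blinfun_apply C x"
  proof -
    have "blinfun_apply B x - blinfun_apply C x \<in> V"
      using assms(1-3) x by (auto simp: so_on_def intro: subspace_diff)
    from eq[OF x this]
    have "(blinfun_apply B x - blinfun_apply C x) \<bullet> (blinfun_apply B x - blinfun_apply C x) = 0"
      by (simp add: inner_diff_left)
    then show ?thesis by simp
  qed
  then show "blinfun_apply B z = blinfun_apply C z"
    using xy(3) y assms(2,3) by (simp add: so_on_def blinfun.add_right)
qed

lemma subspace_so_on: "subspace V \<Longrightarrow> subspace (so_on V)"
  unfolding subspace_def so_on_def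
  by (auto simp: blinfun.add_left blinfun.scaleR_left inner_add)

lemma real_polynomial_function_real_imp_poly:
  fixes f :: "real \<Rightarrow> real"
  assumes "real_polynomial_function f"
  obtains p where "f = poly p"
proof -
  obtain a n where "f = (\<lambda>x. \<Sum>i\<le>n. a i * x ^ i)"
    using assms real_polynomial_function_iff_sum by blast
  then have "f = poly (\<Sum>i\<le>n. monom (a i) i)" by (auto simp: poly_sum poly_monom)
  then show thesis by (rule that)
qed

text \<open>Real polynomials in one variable form an integral domain.\<close>

lemma real_polynomial_function_mult_eq_0:
  fixes f g :: "real \<Rightarrow> real"
  assumes "real_polynomial_function f" "real_polynomial_function g"
    and "\<And>t. f t * g t = 0" and "g s \<noteq> 0"
  shows "f t = 0"
proof -
  obtain p q where pq: "f = poly p" "g = poly q"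
    using real_polynomial_function_real_imp_poly assms(1,2) by metis
  then have "poly (p * q) x = 0" for x using assms(3) by simp
  then have "p * q = 0" using poly_all_0_iff_0 by blast
  moreover have "q \<noteq> 0" using pq(2) assms(4) by auto
  ultimately show ?thesis using pq(1) by simp
qed

text \<open>The line through \<open>x\<close> and a point where \<open>P\<close> and \<open>Q\<close> agree reduces the claim to polynomials
  in one variable, where \<open>(P - Q) (P + Q) = 0\<close> forces one of the factors to vanish.\<close>

lemma polynomial_square_root_unique:
  fixes P Q :: "'v::real_normed_vector \<Rightarrow> real"
  assumes "real_polynomial_function P" "real_polynomial_function Q" "subspace W"
    and sq: "\<And>x. x \<in> W \<Longrightarrow> (P x)\<^sup>2 = (Q x)\<^sup>2"
    and base: "x0 \<in> W" "P x0 = Q x0" "Q x0 \<noteq> 0" and x: "x \<in> W"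
  shows "P x = Q x"
proof -
  define l where "l t = x0 + t *\<^sub>R (x - x0)" for t :: real
  have "polynomial_function l"
    unfolding l_def by (intro polynomial_function_add polynomial_function_mult) auto
  then have "real_polynomial_function (\<lambda>t. P (l t))" "real_polynomial_function (\<lambda>t. Q (l t))"
    using assms(1,2) real_polynomial_function_compose unfolding o_def by blast+
  then have "real_polynomial_function (\<lambda>t. P (l t) - Q (l t))"
      "real_polynomial_function (\<lambda>t. P (l t) + Q (l t))"
    by auto
  moreover have "(P (l t) - Q (l t)) * (P (l t) + Q (l t)) = 0" for t
  proof -
    have "l t \<in> W"
      unfolding l_def using assms(3) base x by (intro subspace_add subspace_scale subspace_diff)
    then show ?thesis using sq[of "l t"] by (simp add: algebra_simps power2_eq_square)
  qed
  moreover have "P (l 0) + Q (l 0) \<noteq> 0" using base by (simp add: l_def)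
  ultimately have "P (l 1) - Q (l 1) = 0"
    using real_polynomial_function_mult_eq_0 by blast
  then show ?thesis by (simp add: l_def)
qed

lemma skew_bilinear_mapsD:
  assumes "mu \<in> skew_bilinear_maps V W"
  shows "bilinear mu" "mu x y = - mu y x"
    and "x \<in> V \<Longrightarrow> y \<in> V \<Longrightarrow> mu x y \<in> W"
    and "z \<in> W \<Longrightarrow> mu x z = 0" "z \<in> W \<Longrightarrow> mu z x = 0"
proof -
  show sk: "mu x y = - mu y x" for x y
    using assms unfolding skew_bilinear_maps_def by blast
  show "bilinear mu" "x \<in> V \<Longrightarrow> y \<in> V \<Longrightarrow> mu x y \<in> W" and 0: "z \<in> W \<Longrightarrow> mu x z = 0"
    using assms unfolding skew_bilinear_maps_def by blast+
  show "z \<in> W \<Longrightarrow> mu z x = 0" using 0 sk[of z x] by simp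
qed

section \<open>Skew operators and the forms they represent\<close>

context matched_orthonormal_basis
begin

lemma so_on_representation:
  assumes bil: "bilinear \<omega>" and sk: "skew_on V \<omega>"
  shows "\<exists>!B. B \<in> so_on V \<and> (\<forall>x\<in>V. \<forall>y\<in>V. blinfun_apply B x \<bullet> y = \<omega> x y)"
proof -
  \<comment> \<open>The Riesz vector of \<open>\<omega> (proj x)\<close> in the basis
    \<open>b\<close>; inserting \<open>proj\<close> makes the operator vanish on the orthogonal
    complement, as \<open>so_on V\<close> demands.\<close>
  let ?f = "\<lambda>x. \<Sum>k\<in>b. \<omega> (proj x) k *\<^sub>R k"
  define B where "B = Blinfun ?f"
  have "linear ?f"
    using bil linear_proj unfolding bilinear_def
    by (auto simp: linear_iff scaleR_add_left sum.distrib scaleR_sum_right)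
  then have B: "blinfun_apply B x = ?f x" for x
    unfolding B_def by (simp add: bounded_linear_Blinfun_apply linear_conv_bounded_linear)
  have Bxy: "blinfun_apply B x \<bullet> y = \<omega> x y" if "x \<in> V" "y \<in> V" for x y
  proof -
    interpret r: linear "\<lambda>y. \<omega> x y" using bil by (simp add: bilinear_def)
    have "blinfun_apply B x \<bullet> y = \<omega> x (proj y)"
      using that(1) by (simp add: B inner_sum_left proj_V)
        (simp add: proj_def r.sum r.scale inner_commute mult.commute)
    then show ?thesis using that(2) proj_V by simp
  qed
  have "B \<in> so_on V"
    unfolding so_on_def
  proof (intro CollectI conjI ballI)
    show "blinfun_apply B x \<in> V" for x
      unfolding B by (intro subspace_sum[OF subspace_V] subspace_scale[OF subspace_V] b_in_V)
    show "blinfun_apply B x \<bullet> y = - (x \<bullet> blinfun_apply B y)" if "x \<in> V" "y \<in> V" for x y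
      using Bxy that skew_onD[OF sk that] by (metis inner_commute)
    show "blinfun_apply B x = 0" if "x \<in> orthogonal_comp V" for x
      unfolding B using that by (simp add: proj_orthogonal bilinear_lzero[OF bil])
  qed
  then show ?thesis
    using Bxy so_on_eqI[OF subspace_V] by (intro ex1I[of _ B]) auto
qed

lemma J_map_apply:
  assumes "mu \<in> skew_bilinear_maps V W"
  shows "J_map V mu Z \<in> so_on V"
    and "x \<in> V \<Longrightarrow> y \<in> V \<Longrightarrow> blinfun_apply (J_map V mu Z) x \<bullet> y = mu x y \<bullet> Z"
proof -
  have "bilinear (\<lambda>x y. mu x y \<bullet> Z)"
    using skew_bilinear_mapsD(1)[OF assms] by (rule bilinear_inner_const)
  moreover have "skew_on V (\<lambda>x y. mu x y \<bullet> Z)"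
    unfolding skew_on_def using skew_bilinear_mapsD(2)[OF assms] by (metis inner_minus_left)
  ultimately have "J_map V mu Z \<in> so_on V \<and>
      (\<forall>x\<in>V. \<forall>y\<in>V. blinfun_apply (J_map V mu Z) x \<bullet> y = mu x y \<bullet> Z)"
    unfolding J_map_def by (intro theI'[OF so_on_representation])
  then show "J_map V mu Z \<in> so_on V"
    "x \<in> V \<Longrightarrow> y \<in> V \<Longrightarrow> blinfun_apply (J_map V mu Z) x \<bullet> y = mu x y \<bullet> Z" by auto
qed

lemma so_on_form:
  assumes "B \<in> so_on V"
  shows "bilinear (\<lambda>x y. blinfun_apply B x \<bullet> y)" "skew_on V (\<lambda>x y. blinfun_apply B x \<bullet> y)"
proof -
  show "bilinear (\<lambda>x y. blinfun_apply B x \<bullet> y)"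
    by (intro bilinear_apply_inner) (simp add: bounded_linear.linear blinfun.bounded_linear_right)
  show "skew_on V (\<lambda>x y. blinfun_apply B x \<bullet> y)"
    unfolding skew_on_def
  proof (intro ballI)
    fix x y assume "x \<in> V" "y \<in> V"
    then have "blinfun_apply B x \<bullet> y = - (x \<bullet> blinfun_apply B y)"
      using assms unfolding so_on_def by blast
    then show "blinfun_apply B x \<bullet> y = - (blinfun_apply B y \<bullet> x)" by (simp only: inner_commute)
  qed
qed

lemma real_polynomial_function_pf:
  "real_polynomial_function (\<lambda>B. pf (\<lambda>x y. blinfun_apply B x \<bullet> y))"
proof -
  have "finite S" using matching by (auto simp: oriented_matching_def finite_subset)
  moreover have "bounded_linear (\<lambda>B. blinfun_apply B x \<bullet> y)" for x y :: 'a
    by (intro bounded_linear_inner_left_comp blinfun.bounded_linear_left)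
  ultimately show ?thesis
    unfolding pf_sum_def
    by (intro real_polynomial_function_sum real_polynomial_function_prod real_polynomial_function.intros)
      (auto simp: finite_b finite_permutations)
qed

end

section \<open>Identification of the Pfaffian with a normalised signed sum\<close>

context hermitian_matched_basis
begin

definition J_blinfun :: "'a \<Rightarrow>\<^sub>L 'a" where
  "J_blinfun = (THE B. B \<in> so_on V \<and> (\<forall>x\<in>V. \<forall>y\<in>V. blinfun_apply B x \<bullet> y = J x \<bullet> y))"

lemma J_blinfun:
  shows "J_blinfun \<in> so_on V" and "x \<in> V \<Longrightarrow> blinfun_apply J_blinfun x = J x"
proof -
  have *: "J_blinfun \<in> so_on V \<and> (\<forall>x\<in>V. \<forall>y\<in>V. blinfun_apply J_blinfun x \<bullet> y = J x \<bullet> y)"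
    unfolding J_blinfun_def by (rule theI'[OF so_on_representation[OF bilinear_J skew_J]])
  then show "J_blinfun \<in> so_on V" by blast
  assume x: "x \<in> V"
  have "blinfun_apply J_blinfun x - J x \<in> V"
    using * x J_V subspace_V by (auto simp: so_on_def intro: subspace_diff)
  then have "(blinfun_apply J_blinfun x - J x) \<bullet> (blinfun_apply J_blinfun x - J x) = 0"
    using * x by (simp add: inner_diff_left)
  then show "blinfun_apply J_blinfun x = J x" by simp
qed

text \<open>The division removes both the combinatorial factor in \<open>pf\<close> and the sign
  that depends on the matching.\<close>

definition normalised_pf :: "('a \<Rightarrow>\<^sub>L 'a) \<Rightarrow> real" where
  "normalised_pf B = pf (\<lambda>x y. blinfun_apply B x \<bullet> y) / pf (\<lambda>x y. J x \<bullet> y)"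

lemma normalised_pf_J: "normalised_pf J_blinfun = 1"
proof -
  have "pf (\<lambda>x y. blinfun_apply J_blinfun x \<bullet> y) = pf (\<lambda>x y. J x \<bullet> y)"
    by (rule pf_cong) (simp add: J_blinfun)
  then show ?thesis using pf_J_nonzero by (simp add: normalised_pf_def)
qed

lemma normalised_pf_squared:
  assumes "B \<in> so_on V"
  shows "(normalised_pf B)\<^sup>2 = fdet (\<lambda>x y. blinfun_apply B x \<bullet> y)"
proof -
  have "(pf (\<lambda>x y. blinfun_apply B x \<bullet> y))\<^sup>2 =
      (pf (\<lambda>x y. J x \<bullet> y))\<^sup>2 * fdet (\<lambda>x y. blinfun_apply B x \<bullet> y)"
    using pf_squared[OF so_on_form[OF assms] bilinear_J skew_J nondegenerate_J] fdet_J by simp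
  then show ?thesis using pf_J_nonzero by (simp add: normalised_pf_def power_divide)
qed

lemma real_polynomial_function_normalised_pf: "real_polynomial_function normalised_pf"
  unfolding normalised_pf_def
  by (intro real_polynomial_function_divide real_polynomial_function_pf)

text \<open>The normalised sum is a polynomial square root of the determinant with value
  \<open>1\<close> at \<open>J_blinfun\<close>. Any competitor agrees with it at that point, where
  the value is nonzero, and hence on the whole subspace \<open>so_on V\<close>.\<close>

lemma pfaffian_eq_normalised_pf:
  assumes det: "\<And>L. det_on V L = fdet (\<lambda>x y. L x \<bullet> y)" and B: "B \<in> so_on V"
  shows "pfaffian V J B = normalised_pf B"
proof -
  let ?P = "restrict normalised_pf (so_on V)"
  have "pfaffian V J = ?P"
    unfolding pfaffian_def
  proof (rule the_equality, goal_cases)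
    case 1
    show ?case
      using real_polynomial_function_normalised_pf J_blinfun normalised_pf_J
      by (auto simp: det normalised_pf_squared)
  next
    case (2 P)
    then obtain Q C where Q: "real_polynomial_function Q" "\<And>B. B \<in> so_on V \<Longrightarrow> P B = Q B"
      and C: "C \<in> so_on V" "\<And>x. x \<in> V \<Longrightarrow> blinfun_apply C x = J x" "P C = 1"
      and sq: "\<And>B. B \<in> so_on V \<Longrightarrow> (P B)\<^sup>2 = det_on V (blinfun_apply B)"
      and ext: "P \<in> extensional (so_on V)"
      by blast
    have "C = J_blinfun"
      by (rule so_on_eqI[OF subspace_V]) (simp_all add: C J_blinfun)
    have "Q B = normalised_pf B" if "B \<in> so_on V" for B
      using polynomial_square_root_unique[OF Q(1) real_polynomial_function_normalised_pf
          subspace_so_on[OF subspace_V], of J_blinfun B]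
        that C(3) J_blinfun(1) normalised_pf_J Q(2) sq \<open>C = J_blinfun\<close>
      by (simp add: normalised_pf_squared det)
    then show ?case using ext Q(2) by (intro extensionalityI[of _ "so_on V"]) auto
  qed
  then show ?thesis using B by simp
qed

end

text \<open>The basis returned is the very one chosen inside \<open>det_on\<close>, which makes the
  determinant formula hold by unfolding.\<close>

lemma matched_orthonormal_basis_exists:
  fixes V :: "'a::euclidean_space set"
  assumes V: "subspace V" and dim: "dim V = 2 * p"
  obtains b S T where "matched_orthonormal_basis V b S T"
    and "\<And>L. det_on V L = leibniz_sum b (\<lambda>x y. L x \<bullet> y)"
proof -
  let ?orthonormal = "\<lambda>b. pairwise orthogonal b \<and> (\<forall>x\<in>b. norm x = 1) \<and> span b = V"
  define b where "b = (SOME b. ?orthonormal b)"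
  have "\<exists>b. ?orthonormal b" using orthonormal_basis_subspace[OF V] by metis
  then have b: "?orthonormal b" unfolding b_def by (rule someI_ex)
  then have "0 \<notin> b" by auto
  then have "independent b" using b by (intro pairwise_orthogonal_independent) auto
  then have "finite b" "card b = 2 * p"
    using b dim by (auto simp: independent_imp_finite dim_eq_card)
  then obtain S T where "oriented_matching b S T" using oriented_matching_exists by metis
  with b have "matched_orthonormal_basis V b S T" by (simp add: matched_orthonormal_basis_def)
  moreover have "det_on V L = leibniz_sum b (\<lambda>x y. L x \<bullet> y)" for L
    by (simp add: det_on_def leibniz_sum_def b_def Let_def)
  ultimately show thesis by (rule that)
qed

section \<open>Pfaffian forms of isomorphic brackets\<close>

theorem proposition3p12:
  fixes n1 n2 :: "'a::euclidean_space set"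
    and J :: "'a \<Rightarrow> 'a"
    and mu lam :: "'a \<Rightarrow> 'a \<Rightarrow> 'a"
    and p q :: nat
  assumes "direct_sum_decomp n1 n2"
    and "dim n1 = 2 * p" and "dim n2 = 2 * q"
    and "linear J" and "\<And>X. J (J X) = - X"
    and "J ` n1 = n1" and "J ` n2 = n2"
    and "\<And>X Y. J X \<bullet> J Y = X \<bullet> Y"
    and "\<And>X Y. X \<in> n1 \<Longrightarrow> Y \<in> n2 \<Longrightarrow> orthogonal X Y"
    and "mu \<in> skew_bilinear_maps n1 n2" and "lam \<in> skew_bilinear_maps n1 n2"
    and "span {mu X Y |X Y. X \<in> n1 \<and> Y \<in> n1} = n2"
    and "span {lam X Y |X Y. X \<in> n1 \<and> Y \<in> n1} = n2"
    and "lam \<in> bracket_orbit J mu"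
  shows "pfaffian_form n1 n2 J lam \<in> pos_form_orbit n2 J (pfaffian_form n1 n2 J mu)"
proof -
  have sub: "subspace n1" "subspace n2" and int: "n1 \<inter> n2 = {0}"
    and sum: "{x + y |x y. x \<in> n1 \<and> y \<in> n2} = UNIV"
    using assms(1) by (auto simp: direct_sum_decomp_def)
  obtain b S T where basis: "matched_orthonormal_basis n1 b S T"
    and det: "\<And>L. det_on n1 L = leibniz_sum b (\<lambda>x y. L x \<bullet> y)"
    using matched_orthonormal_basis_exists[OF sub(1) assms(2)] by blast
  have JV: "x \<in> n1 \<Longrightarrow> J x \<in> n1" "x \<in> n2 \<Longrightarrow> J x \<in> n2" for x using assms(6,7) by auto
  interpret hermitian_matched_basis n1 b S T J
    using basis assms(4,5,8) JV(1)
    by (simp add: hermitian_matched_basis_def hermitian_matched_basis_axioms_def)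

  \<comment> \<open>As \<open>n2\<close> is orthogonal to \<open>n1\<close>, the orthogonal
    projection onto \<open>n1\<close> is the projection along \<open>n2\<close>.\<close>
  have proj_n2: "proj y = 0" if "y \<in> n2" for y
    using that assms(9) by (intro proj_orthogonal) (simp add: orthogonal_comp_def)
  have decomp: "\<exists>u\<in>n1. \<exists>v\<in>n2. x = u + v \<and> proj x = u" for x
  proof -
    obtain u v where "u \<in> n1" "v \<in> n2" "x = u + v" using sum by blast
    then show ?thesis
      by (intro bexI[of _ u] bexI[of _ v]) (auto simp: linear_add[OF linear_proj] proj_V proj_n2)
  qed
  then have proj_compl: "x - proj x \<in> n2" for x by (metis add_diff_cancel_left')
  have proj_J: "proj (J x) = J (proj x)" for x
  proof -
    obtain u v where uv: "u \<in> n1" "v \<in> n2" "x = u + v" "proj x = u" using decomp by blast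
    then show ?thesis
      using JV by (simp add: linear_add[OF linear_J] linear_add[OF linear_proj] proj_V proj_n2)
  qed
  have mu_proj: "mu x y = mu (proj x) (proj y)" for x y
  proof -
    note mu = skew_bilinear_mapsD[OF assms(10)]
    obtain u v where uv: "v \<in> n2" "x = u + v" "proj x = u" using decomp by blast
    obtain u' v' where uv': "v' \<in> n2" "y = u' + v'" "proj y = u'" using decomp by blast
    show ?thesis
      using uv uv' mu(4,5) by (simp add: bilinear_ladd[OF mu(1)] bilinear_radd[OF mu(1)])
  qed
  have mu_n2: "mu x y \<in> n2" for x y
    using skew_bilinear_mapsD(3)[OF assms(10)] mu_proj proj_in_V by metis

  obtain g where lam: "lam = bracket_act g mu" and "g \<in> GL_complex UNIV J"
    using assms(14) by (auto simp: bracket_orbit_def)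
  then have g: "linear g" "bij g" "\<And>x. g (J x) = J (g x)" by (auto simp: GL_complex_def)
  define gi where "gi = inv g"
  have gi: "linear gi" "\<And>x. g (gi x) = x" "\<And>x. gi (g x) = x"
    using g by (auto simp: gi_def bij_is_inj bij_is_surj surj_f_inv_f inj_linear_imp_inv_linear)
  have giJ: "gi (J x) = J (gi x)" for x using g(3) gi(2,3) by metis
  \<comment> \<open>Every value of \<open>lam\<close> is the image under \<open>g\<close> of a value
    of \<open>mu\<close>, and these values span \<open>n2\<close>; comparing dimensions then gives
    equality.\<close>
  have "n2 \<subseteq> g ` n2"
  proof -
    have "lam X Y \<in> g ` n2" for X Y using mu_n2 by (simp add: lam bracket_act_def)
    then have "span {lam X Y |X Y. X \<in> n1 \<and> Y \<in> n1} \<subseteq> g ` n2"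
      using linear_subspace_image[OF g(1) sub(2)] by (intro span_minimal) auto
    then show ?thesis using assms(13) by simp
  qed
  moreover have "dim (g ` n2) = dim n2"
    using g by (intro dim_image_eq) (auto intro: inj_on_subset[OF bij_is_inj])
  ultimately have g_n2: "n2 = g ` n2"
    using linear_subspace_image[OF g(1) sub(2)] sub(2) by (intro subspace_dim_equal) auto
  then have gi_n2: "gi x \<in> n2" if "x \<in> n2" for x using that gi(3) by (metis imageE)
  have g_in_n2: "g x \<in> n2" if "x \<in> n2" for x using that g_n2 by auto

  define a where "a x = proj (gi x)" for x
  have a: "linear a" using linear_compose[OF gi(1) linear_proj] by (simp add: a_def[abs_def] o_def)
  have a_V: "a x \<in> n1" for x by (simp add: a_def proj_in_V)
  \<comment> \<open>A vector killed by \<open>a\<close> is sent into \<open>n2\<close> by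
    \<open>gi\<close>; since \<open>g\<close> preserves \<open>n2\<close>, the vector itself lies in
    both summands.\<close>
  have a_0: "x = 0" if "x \<in> n1" "a x = 0" for x
  proof -
    have "gi x \<in> n2" using proj_compl[of "gi x"] that(2) by (simp add: a_def)
    then have "x \<in> n2" using g_in_n2 gi(2) by metis
    then show ?thesis using that(1) int by blast
  qed
  define r where "r = leibniz_sum b (\<lambda>x y. a x \<bullet> y)"
  have "0 < r"
    unfolding r_def
  proof (rule fdet_complex_linear_pos[OF a a_V a_0])
    show "a (J x) = J (a x)" for x by (simp add: a_def giJ proj_J)
  qed

  \<comment> \<open>\<open>dual f\<close> is the transpose of the restriction of \<open>f\<close> to \<open>n2\<close>.\<close>
  define dual where "dual f Z = adjoint f Z - proj (adjoint f Z)" for f :: "'a \<Rightarrow> 'a" and Z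
  have dual_n2: "dual f Z \<in> n2" for f Z by (simp add: dual_def proj_compl)
  have dual_inner: "w \<bullet> dual f Z = f w \<bullet> Z" if "linear f" "w \<in> n2" for f Z w
  proof -
    have "w \<bullet> proj (adjoint f Z) = 0"
      using assms(9)[OF proj_in_V that(2)] by (simp add: orthogonal_def inner_commute)
    then show ?thesis by (simp add: dual_def inner_diff_right adjoint_works[OF that(1)])
  qed
  have n2_eqI: "x = y" if "x \<in> n2" "y \<in> n2" "\<And>w. w \<in> n2 \<Longrightarrow> w \<bullet> x = w \<bullet> y" for x y
  proof -
    have "(x - y) \<bullet> (x - y) = 0"
      using that(3)[OF subspace_diff[OF sub(2) that(1,2)]] by (simp add: inner_diff_right)
    then show ?thesis by simp
  qed
  have dual_dual: "dual g (dual gi Z) = Z" "dual gi (dual g Z) = Z" if "Z \<in> n2" for Z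
    using that g_in_n2 gi_n2 by (auto intro!: n2_eqI simp: dual_n2 dual_inner g gi)
  \<comment> \<open>\<open>form_act\<close> composes with the inverse of the group element. The
    element to exhibit is therefore \<open>dual gi\<close>, whose inverse on \<open>n2\<close> is
    \<open>dual g\<close>.\<close>
  have bij: "bij_betw (dual gi) n2 n2"
    using dual_dual dual_n2 by (intro bij_betwI[where g = "dual g"]) auto
  have inv_dual: "inv_into n2 (dual gi) Z = dual g Z" if "Z \<in> n2" for Z
    using that bij dual_dual dual_n2 by (intro inv_into_f_eq) (auto simp: bij_betw_def)
  have "linear (dual gi)"
    using adjoint_linear[OF gi(1)] linear_proj unfolding dual_def
    by (intro linear_compose_sub) (auto simp: linear_compose[unfolded o_def])
  \<comment> \<open>\<open>J\<close> is skew for the inner product and commutes with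
    \<open>gi\<close>, so moving it across and back produces two signs that cancel.\<close>
  moreover have "dual gi (J Z) = J (dual gi Z)" if "Z \<in> n2" for Z
  proof (rule n2_eqI)
    fix w assume w: "w \<in> n2"
    have "w \<bullet> dual gi (J Z) = - (gi (J w) \<bullet> Z)"
      using w by (simp add: dual_inner gi giJ J_inner)
    also have "\<dots> = w \<bullet> J (dual gi Z)"
      using w JV by (simp add: dual_inner[OF gi(1), symmetric] J_inner)
    finally show "w \<bullet> dual gi (J Z) = w \<bullet> J (dual gi Z)" .
  qed (use dual_n2 JV in auto)
  ultimately have h: "dual gi \<in> GL_complex n2 J" using bij by (simp add: GL_complex_def)

  have "pfaffian n1 J (J_map n1 lam Z) = r * pfaffian n1 J (J_map n1 mu (dual g Z))"
    if "Z \<in> n2" for Z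
  proof -
    let ?B = "J_map n1 lam Z" and ?C = "J_map n1 mu (dual g Z)"
    note B = J_map_apply[OF assms(11), where Z = Z]
      and C = J_map_apply[OF assms(10), where Z = "dual g Z"]
    have "pf (\<lambda>x y. blinfun_apply ?B x \<bullet> y) = r * pf (\<lambda>x y. blinfun_apply ?C x \<bullet> y)"
      unfolding r_def
    proof (rule pf_congruence[OF so_on_form(1)[OF C(1)]])
      fix x y assume xy: "x \<in> n1" "y \<in> n1"
      \<comment> \<open>The vector \<open>gi x\<close> may leave \<open>n1\<close>, but
        \<open>mu\<close> sees only its component \<open>a x\<close>. The outer \<open>g\<close>
        then passes to the other side of the inner product as \<open>dual g\<close>, because
        \<open>mu\<close> takes values in \<open>n2\<close>.\<close>
      have "lam x y = g (mu (a x) (a y))"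
        using mu_proj by (simp add: lam bracket_act_def a_def gi_def)
      then show "blinfun_apply ?B x \<bullet> y = blinfun_apply ?C (a x) \<bullet> a y"
        by (simp add: B C xy a_V dual_inner g mu_n2)
    qed (rule a_V)
    \<comment> \<open>Both Pfaffians have the same denominator, the sum at \<open>J\<close>, so the
      factor \<open>r\<close> survives normalisation.\<close>
    then show ?thesis
      using B(1) C(1) by (simp add: pfaffian_eq_normalised_pf[OF det] normalised_pf_def)
  qed
  then have "pfaffian_form n1 n2 J lam =
      (\<lambda>Z\<in>n2. r * form_act n2 (dual gi) (pfaffian_form n1 n2 J mu) Z)"
    unfolding pfaffian_form_def form_act_def by (auto simp: inv_dual dual_n2)
  then show ?thesis using \<open>0 < r\<close> h unfolding pos_form_orbit_def by blast
qed

end
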